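(* Let $\{\phi_t : t\ge 0\}$ be a semigroup of analytic self-maps of the upper half-plane $\mathbb{U}$ with infinitesimal generator $G$, and let $0<p<\infty$. For $t\ge0$ let $T_t(f)=f\circ\phi_t$. Then the following are equivalent: (1) Each composition operator $T_t$ is bounded on $H^p(\mathbb{U})$. (2) The non-tangential limit $\delta:=\angle\lim_{z\to\infty}\frac{G(z)}{z}$ exists finitely. (3) The non-tangential limit $\angle\lim_{z\to\infty}G'(z)$ exists finitely. Moreover, if one of these assertions holds, then (i) $\delta=\angle\lim_{z\to\infty}G'(z)\in\mathbb{R}$, and (ii) $\|T_t\|=e^{-\delta t/p}$ for each $t\ge0$.
   Context: $\mathbb{U}=\{z\in\mathbb{C}:\operatorname{Im} z>0\}$. For $0<p<\infty$, $H^p(\mathbb{U})$ is the space of analytic $f:\mathbb{U}\to\mathbb{C}$ with $\|f\|_p=\sup_{y>0}\left(\int_{-\infty}^{\infty}|f(x+iy)|^p\,dx\right)^{1/p}<\infty$. A composition operator $f\mapsto f\circ\phi$ is bounded on $H^p(\mathbb{U})$ if there is a constant $C$ with $f\circ\phi\in H^p(\mathbb{U})$ and $\|f\circ\phi\|_p\le C\|f\|_p$ for all $f\in H^p(\mathbb{U})$; its norm is the least such $C$. A semigroup of analytic self-maps of $\mathbb{U}$ is a family $\{\phi_t:t\ge0\}$ of analytic maps $\phi_t:\mathbb{U}\to\mathbb{U}$ such that $\phi_0(z)\equiv z$, $\phi_{t+s}=\phi_t\circ\phi_s$ for $t,s\ge0$, and $(t,z)\mapsto\phi_t(z)$ is jointly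 continuous on $[0,\infty)\times\mathbb{U}$. Its infinitesimal generator is the analytic function $G:\mathbb{U}\to\mathbb{C}$, $G(z)=\lim_{t\to0}\frac{\partial\phi_t(z)}{\partial t}$ (it always exists, and $G(\phi_t(z))=\frac{\partial\phi_t(z)}{\partial t}$ for $z\in\mathbb{U}$, $t\ge0$). For $u>0$ let $T_u(\infty)=\{x+iy\in\mathbb{U}:|x|<uy\}$. For a function $f$ on $\mathbb{U}$, $\angle\lim_{z\to\infty}f(z)=c$ means that for every $u>0$, $f(z)\to c$ as $z\to\infty$ within $T_u(\infty)$; the limit exists finitely if this holds for some $c\in\mathbb{C}$. *)

theory Defs
  imports "HOL-Analysis.Analysis"
begin

definition upper_half_plane :: "complex set" where
  "upper_half_plane = {z. Im z > 0}"

text \<open>Elements of the Hardy space are total functions of which only the values on the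
  upper half-plane matter. On each horizontal line a member is continuous, so integrability
  just says that the integral in the norm is finite. \<open>hardy_norm p f\<close> is meaningful only
  for members of \<open>hardy_space p\<close>.\<close>

definition hardy_mean :: "real \<Rightarrow> (complex \<Rightarrow> complex) \<Rightarrow> real \<Rightarrow> real" where
  "hardy_mean p f y = (LINT x|lborel. norm (f (Complex x y)) powr p) powr (1 / p)"

definition hardy_space :: "real \<Rightarrow> (complex \<Rightarrow> complex) set" where
  "hardy_space p = {f. f holomorphic_on upper_half_plane \<and>
     (\<forall>y>0. integrable lborel (\<lambda>x. norm (f (Complex x y)) powr p)) \<and>
     bdd_above (hardy_mean p f ` {0<..})}"

definition hardy_norm :: "real \<Rightarrow> (complex \<Rightarrow> complex) \<Rightarrow> real" where
  "hardy_norm p f = (SUP y\<in>{0<..}. hardy_mean p f y)"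

definition comp_op :: "(complex \<Rightarrow> complex) \<Rightarrow> (complex \<Rightarrow> complex) \<Rightarrow> (complex \<Rightarrow> complex)" where
  "comp_op \<phi> f = f \<circ> \<phi>"

definition hardy_bound ::
    "real \<Rightarrow> ((complex \<Rightarrow> complex) \<Rightarrow> (complex \<Rightarrow> complex)) \<Rightarrow> real \<Rightarrow> bool" where
  "hardy_bound p T C \<longleftrightarrow>
     (\<forall>f\<in>hardy_space p. T f \<in> hardy_space p \<and> hardy_norm p (T f) \<le> C * hardy_norm p f)"

definition hardy_bounded ::
    "real \<Rightarrow> ((complex \<Rightarrow> complex) \<Rightarrow> (complex \<Rightarrow> complex)) \<Rightarrow> bool" where
  "hardy_bounded p T \<longleftrightarrow> (\<exists>C. hardy_bound p T C)"

definition hardy_opnorm ::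
    "real \<Rightarrow> ((complex \<Rightarrow> complex) \<Rightarrow> (complex \<Rightarrow> complex)) \<Rightarrow> real" where
  "hardy_opnorm p T = (LEAST C. hardy_bound p T C)"

definition analytic_semigroup :: "(real \<Rightarrow> complex \<Rightarrow> complex) \<Rightarrow> bool" where
  "analytic_semigroup \<phi> \<longleftrightarrow>
     (\<forall>t\<ge>0. \<phi> t holomorphic_on upper_half_plane \<and>
            \<phi> t ` upper_half_plane \<subseteq> upper_half_plane) \<and>
     (\<forall>z\<in>upper_half_plane. \<phi> 0 z = z) \<and>
     (\<forall>t\<ge>0. \<forall>s\<ge>0. \<forall>z\<in>upper_half_plane. \<phi> (t + s) z = \<phi> t (\<phi> s z)) \<and>
     continuous_on ({0..} \<times> upper_half_plane) (\<lambda>(t, z). \<phi> t z)"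

text \<open>\<open>D t\<close> is the time derivative at \<open>t > 0\<close> of the trajectory through \<open>z\<close>. Every analytic
  semigroup has a generator, and the generator is unique on the upper half-plane.\<close>

definition infinitesimal_generator ::
    "(real \<Rightarrow> complex \<Rightarrow> complex) \<Rightarrow> (complex \<Rightarrow> complex) \<Rightarrow> bool" where
  "infinitesimal_generator \<phi> G \<longleftrightarrow>
     G holomorphic_on upper_half_plane \<and>
     (\<forall>z\<in>upper_half_plane. \<exists>D.
        (\<forall>t>0. ((\<lambda>s. \<phi> s z) has_vector_derivative D t) (at t)) \<and>
        (D \<longlongrightarrow> G z) (at_right 0))"

definition sector_infinity :: "real \<Rightarrow> complex set" where
  "sector_infinity u = {z\<in>upper_half_plane. \<bar>Re z\<bar> < u * Im z}"

definition nontangential_limit :: "(complex \<Rightarrow> complex) \<Rightarrow> complex \<Rightarrow> bool" where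
  "nontangential_limit f c \<longleftrightarrow>
     (\<forall>u>0. (f \<longlongrightarrow> c) (inf at_infinity (principal (sector_infinity u))))"

end

theory Submission
  imports Defs "HOL-Complex_Analysis.Complex_Analysis"
begin

text \<open>
  Everything is governed by the best constant \<open>b\<close> in \<open>Im (\<phi> t z) \<ge> b * Im z\<close>, and by the best constant \<open>d\<close> in the
  infinitesimal inequality \<open>Im (G z) \<ge> d * Im z\<close>.

  \<^emph>\<open>Operators.\<close> If \<open>\<phi>\<close> satisfies \<open>Im (\<phi> z) \<ge> c * Im z\<close> with \<open>c > 0\<close>, then composition with \<open>\<phi>\<close> has norm at most
  \<open>(1 / c) powr (1 / p)\<close> (\<open>composition_bounded\<close>). For \<open>norm (f z) powr p\<close> is subharmonic, also for \<open>p < 1\<close>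
  because zeros can be removed by Blaschke factors, and so it is dominated by a Poisson integral over a
  horizontal line (\<open>hardy_poisson\<close>); after composition with \<open>\<phi>\<close> and integration, the Poisson kernel contributes
  mass at most \<open>1 / c\<close> (\<open>kernel_mass_pulled_back\<close>). Conversely, boundedness with constant \<open>C\<close> gives such a
  \<open>c\<close>, up to a factor \<open>16 * pi\<close> (\<open>composition_bound_imp\<close>). For a semigroup the factor is removed by
  passing to \<open>\<phi> (n * t)\<close> and taking \<open>n\<close>-th roots (\<open>hardy_opnorm_flow\<close>).

  \<^emph>\<open>Generator.\<close> A bound \<open>Im (G z) \<ge> d * Im z\<close> integrates along orbits to \<open>Im (\<phi> t z) \<ge> exp (d * t) * Im z\<close>
  (\<open>flow_lower_bound\<close>). If \<open>G z / z\<close> has the nontangential limit \<open>\<delta>\<close>, then the bound holds with \<open>d = Re \<delta>\<close>: the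
  infinitesimal form of the Schwarz--Pick inequality for two points says so when one of
  the points goes to infinity (\<open>generator_lower_bound_of_limit\<close>). In the other direction, if every \<open>\<phi> t\<close> has a positive
  constant, then the Julia--Wolff--Caratheodory theorem identifies these constants with angular
  derivatives at infinity, which are multiplicative under composition; taking small times gives a lower bound
  for \<open>G\<close> (\<open>generator_lower_bound_of_flow\<close>). Applied to \<open>G\<close>, the same theorem yields a real limit \<open>\<delta>\<close> of \<open>G z / z\<close>, and the
  best constant for \<open>\<phi> t\<close> is exactly \<open>exp (\<delta> * t)\<close> (\<open>sharp_flow_bound\<close>).

  The limits of \<open>G z / z\<close> and of \<open>deriv G\<close> agree for any holomorphic \<open>G\<close>, by Cauchy's estimate and the mean value
  inequality in sectors.
\<close>

section \<open>Powers of moduli and circle means\<close>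

lemma mean_value_circle:
  assumes "g holomorphic_on S" "cball 0 1 \<subseteq> S" "0 < r" "r \<le> 1"
  shows "((\<lambda>\<tau>. g (circlepath 0 r \<tau>)) has_integral g 0) {0..1}"
proof -
  have "cball 0 r \<subseteq> S" using assms by (force intro: order_trans)
  then have "g holomorphic_on cball 0 r" using assms(1) by (rule holomorphic_on_subset[rotated])
  from Cauchy_integral_circlepath_simple[OF this, of 0] assms
  have "((\<lambda>u. g u / u) has_contour_integral (2 * of_real pi * \<i> * g 0)) (circlepath 0 r)" by simp
  then have "((\<lambda>\<tau>. g (circlepath 0 r \<tau>) / circlepath 0 r \<tau> *
      vector_derivative (circlepath 0 r) (at \<tau> within {0..1})) has_integral (2 * of_real pi * \<i> * g 0)) {0..1}"
    by (simp add: has_contour_integral_def)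
  then have "((\<lambda>\<tau>. (2 * of_real pi * \<i>) * g (circlepath 0 r \<tau>)) has_integral (2 * of_real pi * \<i> * g 0)) {0..1}"
    using assms by (elim has_integral_eq[rotated], simp add: vector_derivative_circlepath01)
      (simp add: circlepath)
  from has_integral_mult_right[OF this, of "inverse (2 * of_real pi * \<i>)"]
  show ?thesis by (simp add: field_simps)
qed

text \<open>
  The crude kernel bound \<open>1 / (1 - norm a)\<close> is sharp at the centre of the disc, and only there is
  sharpness needed; away from the centre any bound uniform for \<open>norm a \<le> 1/2\<close> will do.
\<close>
lemma norm_le_circle_mean:
  assumes "g holomorphic_on S" "cball 0 1 \<subseteq> S" "norm a < 1"
  shows "norm (g a) \<le> integral {0..1} (\<lambda>\<tau>. norm (g (circlepath 0 1 \<tau>))) / (1 - norm a)"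
proof -
  have hol: "g holomorphic_on cball 0 1" using assms(1,2) holomorphic_on_subset by blast
  have cont: "continuous_on (cball 0 1) g" using hol holomorphic_on_imp_continuous_on by blast
  have cc: "continuous_on {0..1} (\<lambda>\<tau>. g (circlepath 0 1 \<tau>))"
    by (rule continuous_on_compose2[OF cont]) (auto simp: circlepath norm_mult intro!: continuous_intros)
  from Cauchy_integral_circlepath_simple[OF hol, of a] assms
  have "((\<lambda>u. g u / (u - a)) has_contour_integral (2 * of_real pi * \<i> * g a)) (circlepath 0 1)" by simp
  then have "((\<lambda>\<tau>. g (circlepath 0 1 \<tau>) / (circlepath 0 1 \<tau> - a) *
      (2 * of_real pi * \<i> * exp (2 * of_real pi * \<i> * \<tau>))) has_integral (2 * of_real pi * \<i> * g a)) {0..1}"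
    unfolding has_contour_integral_def
    by (elim has_integral_eq[rotated]) (simp add: vector_derivative_circlepath01)
  note I = this
  have "norm (integral {0..1} (\<lambda>\<tau>. g (circlepath 0 1 \<tau>) / (circlepath 0 1 \<tau> - a) *
      (2 * of_real pi * \<i> * exp (2 * of_real pi * \<i> * \<tau>)))) \<le> 
     integral {0..1} (\<lambda>\<tau>. 2 * pi * norm (g (circlepath 0 1 \<tau>)) / (1 - norm a))"
  proof (rule integral_norm_bound_integral[OF has_integral_integrable[OF I]])
    show "(\<lambda>\<tau>. 2 * pi * norm (g (circlepath 0 1 \<tau>)) / (1 - norm a)) integrable_on {0..1}"
      by (intro integrable_continuous_real continuous_intros cc) (use assms in auto)
    fix \<tau> :: real assume "\<tau> \<in> {0..1}"
    have "1 - norm a \<le> norm (circlepath 0 1 \<tau> - a)"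
      using norm_triangle_ineq2[of "circlepath 0 1 \<tau>" a] by (simp add: circlepath)
    then have "norm (g (circlepath 0 1 \<tau>)) / norm (circlepath 0 1 \<tau> - a) \<le> norm (g (circlepath 0 1 \<tau>)) / (1 - norm a)"
      using assms(3) by (intro divide_left_mono mult_pos_pos) auto
    from mult_left_mono[OF this, of "2 * pi"] show "norm (g (circlepath 0 1 \<tau>) / (circlepath 0 1 \<tau> - a) *
      (2 * of_real pi * \<i> * exp (2 * of_real pi * \<i> * \<tau>))) \<le> 2 * pi * norm (g (circlepath 0 1 \<tau>)) / (1 - norm a)"
      by (simp add: norm_mult norm_divide mult_ac)
  qed
  also have "\<dots> = 2 * pi * (integral {0..1} (\<lambda>\<tau>. norm (g (circlepath 0 1 \<tau>))) / (1 - norm a))"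
    by simp
  finally have "(2 * pi) * norm (g a) \<le> (2 * pi) * (integral {0..1} (\<lambda>\<tau>. norm (g (circlepath 0 1 \<tau>))) / (1 - norm a))"
    unfolding integral_unique[OF I] by (simp add: norm_mult)
  then show ?thesis by (rule mult_left_le_imp_le) simp
qed

lemma remove_one_zero:
  assumes f: "f holomorphic_on ball 0 R" and nc: "\<not> f constant_on ball 0 R"
    and a: "norm a < R" "f a = 0"
  obtains g n where "g holomorphic_on ball 0 R" "\<And>w. w \<in> ball 0 R \<Longrightarrow> f w = (w - a) ^ n * g w" "g a \<noteq> 0"
proof -
  have aS: "a \<in> ball 0 R" using a by simp
  obtain h r n where n: "0 < n" "0 < r" "ball a r \<subseteq> ball 0 R" "h holomorphic_on ball a r"
     and fh: "\<And>w. w \<in> ball a r \<Longrightarrow> f w = (w - a) ^ n * h w" 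
     and h0: "\<And>w. w \<in> ball a r \<Longrightarrow> h w \<noteq> 0"
    using holomorphic_factor_zero_nonconstant[OF f open_ball connected_ball aS a(2) nc] by metis
  define g where "g = (\<lambda>w. if w = a then h a else f w / (w - a) ^ n)"
  have gh: "g w = h w" if "w \<in> ball a r" for w
    using fh[OF that] by (simp add: g_def)
  have "g holomorphic_on ball a r" using n(4) by (rule holomorphic_transform) (simp add: gh)
  moreover have "(\<lambda>w. f w / (w - a) ^ n) holomorphic_on (ball 0 R - {a})"
    by (intro holomorphic_intros holomorphic_on_subset[OF f]) auto
  then have "g holomorphic_on (ball 0 R - {a})"
    by (rule holomorphic_transform) (simp add: g_def)
  ultimately have "g holomorphic_on (ball a r \<union> (ball 0 R - {a}))"
    by (intro holomorphic_on_Un) auto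
  then have "g holomorphic_on ball 0 R" by (rule holomorphic_on_subset) (use n in auto)
  moreover have "f w = (w - a) ^ n * g w" if "w \<in> ball 0 R" for w
    using n a by (simp add: g_def)
  moreover have "g a \<noteq> 0" using gh[of a] h0[of a] n by simp
  ultimately show ?thesis using that by blast
qed

lemma blaschke_norm_eq:
  assumes "norm w = 1" shows "norm (1 - cnj a * w) = norm (w - a)"
proof -
  have "1 - cnj a * w = w * cnj (w - a)"
    using assms complex_norm_square[of w] by (simp add: algebra_simps)
  then show ?thesis by (metis assms complex_mod_cnj mult_1 norm_mult)
qed

lemma blaschke_norm_le:
  assumes "norm a < 1" "norm w \<le> 1" shows "norm (w - a) \<le> norm (1 - cnj a * w)"
proof -
  have "norm (1 - cnj a * w)^2 - norm (w - a)^2 = (1 - norm a^2) * (1 - norm w^2)"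
    unfolding cmod_power2 by (simp add: algebra_simps power2_eq_square)
  moreover have "norm a^2 \<le> 1" "norm w^2 \<le> 1" using assms by (auto simp: power_le_one)
  ultimately have "norm (w - a)^2 \<le> norm (1 - cnj a * w)^2"
    by (metis diff_ge_0_iff_ge mult_nonneg_nonneg)
  then show ?thesis by (rule power2_le_imp_le) simp
qed

text \<open>
  A zero \<open>a\<close> of order \<open>n\<close> is replaced by the factor \<open>(1 - cnj a * w) ^ n\<close>, that is, the function is divided
  by a power of a Blaschke factor: the modulus stays the same on the circle and can only grow inside.
  The result has a logarithm, so it has powers with arbitrary real exponents.
\<close>
lemma zero_free_majorant:
  assumes "f holomorphic_on ball 0 R" "1 < R" "\<And>w. norm w = 1 \<Longrightarrow> f w \<noteq> 0"
  obtains F where "F holomorphic_on ball 0 R" "\<And>w. norm w \<le> 1 \<Longrightarrow> F w \<noteq> 0"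
    "\<And>w. norm w = 1 \<Longrightarrow> norm (F w) = norm (f w)" "\<And>w. norm w < 1 \<Longrightarrow> norm (f w) \<le> norm (F w)"
proof -
  have "\<exists>F. F holomorphic_on ball 0 R \<and> (\<forall>w. norm w \<le> 1 \<longrightarrow> F w \<noteq> 0) \<and>
    (\<forall>w. norm w = 1 \<longrightarrow> norm (F w) = norm (f w)) \<and> (\<forall>w. norm w < 1 \<longrightarrow> norm (f w) \<le> norm (F w))"
    using assms
  proof (induction "card {w. norm w < 1 \<and> f w = 0}" arbitrary: f rule: less_induct)
    case less
    show ?case
    proof (cases "\<exists>a. norm a < 1 \<and> f a = 0")
      case False
      then have "\<forall>w. norm w \<le> 1 \<longrightarrow> f w \<noteq> 0" using less.prems(3) by (metis le_less)
      then show ?thesis using less.prems by blast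
    next
      case True
      then obtain a where a: "norm a < 1" "f a = 0" by blast
      have nc: "\<not> f constant_on ball 0 R"
        using less.prems(2,3) a unfolding constant_on_def
        by (metis mem_ball_0 norm_one order_less_trans)
      obtain g n where g: "g holomorphic_on ball 0 R" 
        "\<And>w. w \<in> ball 0 R \<Longrightarrow> f w = (w - a) ^ n * g w" "g a \<noteq> 0"
        using remove_one_zero[OF less.prems(1) nc, of a] a less.prems(2) by (metis order_less_trans)
      define F where "F = (\<lambda>w. (1 - cnj a * w) ^ n * g w)"
      have F: "F holomorphic_on ball 0 R" unfolding F_def by (intro holomorphic_intros g)
      have nz: "1 - cnj a * w \<noteq> 0" if "norm w < 1" for w
      proof -
        have "norm (cnj a * w) < 1" using that a norm_mult_less[of "cnj a" 1 w 1] by simp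
        then show ?thesis by force
      qed
      have S: "norm (F w) = norm (f w)" if "norm w = 1" for w
        using that less.prems(2) blaschke_norm_eq[OF that, of a] by (simp add: F_def g(2) norm_mult norm_power)
      have B: "norm (f w) \<le> norm (F w)" if "norm w < 1" for w
        using that less.prems(2) blaschke_norm_le[OF a(1), of w]
        by (simp add: F_def g(2) norm_mult norm_power mult_right_mono power_mono)
      have fin: "finite {w. norm w < 1 \<and> f w = 0}"
      proof (rule finite_subset)
        show "finite {w \<in> cball 0 1. f w = 0}"
          by (rule holomorphic_compact_finite_zeros[OF less.prems(1) open_ball connected_ball compact_cball _ nc])
            (use less.prems(2) in auto)
      qed auto
      have "{w. norm w < 1 \<and> F w = 0} \<subseteq> {w. norm w < 1 \<and> f w = 0} - {a}"
        using g less.prems(2) nz by (auto simp: F_def)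
      also have "\<dots> \<subset> {w. norm w < 1 \<and> f w = 0}" using a by blast
      finally have "card {w. norm w < 1 \<and> F w = 0} < card {w. norm w < 1 \<and> f w = 0}"
        using fin psubset_card_mono by blast
      moreover have "\<And>w. norm w = 1 \<Longrightarrow> F w \<noteq> 0" using S less.prems(3) by (metis norm_eq_zero)
      ultimately have "\<exists>H. H holomorphic_on ball 0 R \<and> (\<forall>w. norm w \<le> 1 \<longrightarrow> H w \<noteq> 0) \<and>
        (\<forall>w. norm w = 1 \<longrightarrow> norm (H w) = norm (F w)) \<and> (\<forall>w. norm w < 1 \<longrightarrow> norm (F w) \<le> norm (H w))"
        using F less.prems(2) by (intro less.hyps)
      then obtain H where H: "H holomorphic_on ball 0 R" "\<forall>w. norm w \<le> 1 \<longrightarrow> H w \<noteq> 0"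
        "\<forall>w. norm w = 1 \<longrightarrow> norm (H w) = norm (F w)" "\<forall>w. norm w < 1 \<longrightarrow> norm (F w) \<le> norm (H w)"
        by blast
      show ?thesis
      proof (intro exI[of _ H] conjI allI impI H(1))
        show "H w \<noteq> 0" if "norm w \<le> 1" for w using H(2) that by simp
        show "norm (H w) = norm (f w)" if "norm w = 1" for w using H(3) S that by simp
        show "norm (f w) \<le> norm (H w)" if "norm w < 1" for w using H(4) B[OF that] that by (meson order_trans)
      qed
    qed
  qed
  then show ?thesis using that by blast
qed

text \<open>
  Since the zero-free majorant is an exponential, its \<open>p\<close>-th power is the modulus of a
  holomorphic function. This covers exponents below 1, where convexity is not available.
\<close>
lemma powr_le_circle_mean_aux:
  assumes "f holomorphic_on ball 0 R" "1 < R" "\<And>w. norm w = 1 \<Longrightarrow> f w \<noteq> 0" "norm a < 1" "0 < p"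
  shows "norm (f a) powr p \<le> integral {0..1} (\<lambda>\<tau>. norm (f (circlepath 0 1 \<tau>)) powr p) / (1 - norm a)"
proof -
  obtain F where F: "F holomorphic_on ball 0 R" "\<And>w. norm w \<le> 1 \<Longrightarrow> F w \<noteq> 0"
    "\<And>w. norm w = 1 \<Longrightarrow> norm (F w) = norm (f w)" "\<And>w. norm w < 1 \<Longrightarrow> norm (f w) \<le> norm (F w)"
    using zero_free_majorant[OF assms(1-3)] by metis
  have "open {w \<in> ball 0 R. F w \<in> - {0}}"
    by (rule continuous_open_preimage[OF holomorphic_on_imp_continuous_on[OF F(1)] open_ball, of "- {0}", unfolded vimage_def Int_def mem_Collect_eq]) auto
  moreover have "cball 0 1 \<subseteq> {w \<in> ball 0 R. F w \<in> - {0}}" using F(2) assms(2) by auto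
  ultimately obtain e where e: "0 < e" "(\<Union>x\<in>cball 0 1. cball x e) \<subseteq> {w \<in> ball 0 R. F w \<in> - {0}}"
    by (rule compact_subset_open_imp_cball_epsilon_subset[OF compact_cball])
  have "ball 0 (1 + e) \<subseteq> (\<Union>x\<in>cball (0::complex) 1. cball x e)"
  proof
    fix w :: complex assume w: "w \<in> ball 0 (1 + e)"
    show "w \<in> (\<Union>x\<in>cball (0::complex) 1. cball x e)"
    proof (cases "norm w \<le> 1")
      case True then show ?thesis using e by (auto intro!: bexI[of _ w])
    next
      case False
      have "dist (sgn w) w = norm w - 1"
      proof -
        have "w - sgn w = of_real (1 - 1 / norm w) * w"
          using False by (simp add: sgn_div_norm scaleR_conv_of_real algebra_simps divide_inverse)
        then have "norm (w - sgn w) = \<bar>1 - 1 / norm w\<bar> * norm w" by (metis norm_mult norm_of_real)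
        also have "\<dots> = norm w - 1" using False by (auto simp: field_simps abs_if)
        finally show ?thesis by (simp add: dist_norm norm_minus_commute)
      qed
      then show ?thesis using w False by (auto intro!: bexI[of _ "sgn w"] simp: norm_sgn)
    qed
  qed
  then have sub: "ball 0 (1 + e) \<subseteq> {w \<in> ball 0 R. F w \<in> - {0}}" using e by blast
  have "F holomorphic_on ball 0 (1 + e)" using sub by (intro holomorphic_on_subset[OF F(1)]) auto
  moreover have "F w \<noteq> 0" if "w \<in> ball 0 (1 + e)" for w using sub that by blast
  ultimately obtain L where L: "L holomorphic_on ball 0 (1 + e)" "\<And>w. w \<in> ball 0 (1 + e) \<Longrightarrow> F w = exp (L w)"
    using contractible_imp_holomorphic_log[OF _ convex_imp_contractible[OF convex_ball]] by metis
  define g where "g = (\<lambda>w. exp (of_real p * L w))"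
  have g: "g holomorphic_on ball 0 (1 + e)" unfolding g_def by (intro holomorphic_intros L)
  have ng: "norm (g w) = norm (F w) powr p" if "norm w \<le> 1" for w
  proof -
    have "F w = exp (L w)" using L(2)[of w] that e by simp
    then show ?thesis by (simp add: g_def powr_def)
  qed
  have "norm (f a) powr p \<le> norm (g a)"
    using ng[of a] F(4)[of a] assms by (simp add: powr_mono2)
  also have "\<dots> \<le> integral {0..1} (\<lambda>\<tau>. norm (g (circlepath 0 1 \<tau>))) / (1 - norm a)"
    using norm_le_circle_mean[OF g _ assms(4)] e by force
  also have "(\<lambda>\<tau>. norm (g (circlepath 0 1 \<tau>))) = (\<lambda>\<tau>. norm (f (circlepath 0 1 \<tau>)) powr p)"
    by (rule ext) (simp add: ng F(3) circlepath)
  finally show ?thesis .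
qed

text \<open>
  Zeros on the circle itself are avoided by shrinking the circle slightly: all but finitely many radii
  are good, and both sides depend continuously on the radius.
\<close>
lemma powr_le_circle_mean:
  assumes f: "f holomorphic_on ball 0 R" and R: "1 < R" and a: "norm a < 1" and p: "0 < p"
  shows "norm (f a) powr p \<le> integral {0..1} (\<lambda>\<tau>. norm (f (circlepath 0 1 \<tau>)) powr p) / (1 - norm a)"
proof (cases "f constant_on ball 0 R")
  case True
  then obtain c where c: "\<And>w. w \<in> ball 0 R \<Longrightarrow> f w = c" unfolding constant_on_def by blast
  have "f (circlepath 0 1 \<tau>) = c" for \<tau> using R by (intro c) (simp add: circlepath)
  moreover have "f a = c" using R a by (intro c) simp
  moreover have "norm c powr p * (1 - norm a) \<le> norm c powr p * 1" by (intro mult_left_mono) auto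
  ultimately show ?thesis using a by (simp add: field_simps)
next
  case False
  define Z where "Z = {w\<in>cball 0 1. f w = 0}"
  have "finite Z" unfolding Z_def
    by (rule holomorphic_compact_finite_zeros[OF f open_ball connected_ball compact_cball _ False]) (use R in auto)
  then have finM: "finite (norm ` Z)" by simp
  have ev: "eventually (\<lambda>r. r \<notin> norm ` Z) (at_left 1)"
  proof -
    have "eventually (\<lambda>r. r \<notin> norm ` Z) (at (1::real))"
      using islimpt_finite[OF finM, of 1] by (auto simp: islimpt_iff_eventually)
    then show ?thesis by (rule filter_leD[OF at_le, rotated]) auto
  qed
  define I where "I = (\<lambda>r::real. integral {0..1} (\<lambda>\<tau>. norm (f (of_real r * circlepath 0 1 \<tau>)) powr p))"
  have contf: "continuous_on (ball 0 R) f" using f holomorphic_on_imp_continuous_on by blast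
  have "continuous_on {0..1} I"
  proof -
    have "continuous_on ({0..1} \<times> cbox 0 1) (\<lambda>(r, \<tau>). norm (f (of_real r * circlepath 0 1 \<tau>)) powr p)"
      unfolding case_prod_unfold
      by (intro continuous_intros continuous_on_powr' continuous_on_compose2[OF contf])
         (use R p in \<open>auto simp: circlepath norm_mult intro!: continuous_intros\<close>)
    from integral_continuous_on_param[OF this] show ?thesis by (simp add: I_def)
  qed
  then have "(I \<longlongrightarrow> I 1) (at 1 within {0..1})" by (simp add: continuous_on_def)
  then have lim1: "(I \<longlongrightarrow> I 1) (at_left 1)"
    by (simp add: at_within_Icc_at_left)
  have "((\<lambda>r. norm (f (of_real r * a)) powr p) \<longlongrightarrow> norm (f (of_real 1 * a)) powr p) (at 1 within {0..1})"
  proof -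
    have "continuous_on {0..1} (\<lambda>r. norm (f (of_real r * a)) powr p)"
      by (intro continuous_intros continuous_on_powr' continuous_on_compose2[OF contf])
        (use R a p in \<open>auto simp: norm_mult intro!: le_less_trans[OF mult_left_le_one_le]\<close>)
    then show ?thesis unfolding continuous_on_def by (rule bspec) simp
  qed
  then have lim2: "((\<lambda>r. norm (f (of_real r * a)) powr p) \<longlongrightarrow> norm (f a) powr p) (at_left 1)"
    by (simp add: at_within_Icc_at_left)
  have "eventually (\<lambda>r. norm (f (of_real r * a)) powr p \<le> I r / (1 - norm a)) (at_left 1)"
    using ev eventually_at_left_real[of 0 "1::real", simplified]
  proof eventually_elim
    case (elim r)
    then have r: "0 < r" "r < 1" by auto
    have hol: "(\<lambda>w. f (of_real r * w)) holomorphic_on ball 0 R"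
    proof (rule holomorphic_on_compose_gen[of "\<lambda>w. of_real r * w" _ f, unfolded o_def])
      show "(*) (complex_of_real r) ` ball 0 R \<subseteq> ball 0 R"
        using r by (auto simp: norm_mult intro!: le_less_trans[OF mult_left_le_one_le])
    qed (auto intro!: holomorphic_intros f)
    have nz: "f (of_real r * w) \<noteq> 0" if "norm w = 1" for w
    proof
      assume "f (of_real r * w) = 0"
      then have "of_real r * w \<in> Z" using r that by (simp add: Z_def norm_mult)
      then have "norm (of_real r * w) \<in> norm ` Z" by (rule imageI)
      then show False using elim r that by (simp add: norm_mult)
    qed
    show ?case unfolding I_def
      by (rule powr_le_circle_mean_aux[OF hol R nz a p])
  qed
  then have "norm (f a) powr p \<le> I 1 / (1 - norm a)"
    by (intro tendsto_le[OF _ _ lim2, of "\<lambda>r. I r / (1 - norm a)"])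
       (use a in \<open>auto intro!: tendsto_intros lim1\<close>)
  then show ?thesis by (simp add: I_def)
qed

section \<open>The Poisson inequality in the half-plane\<close>

text \<open>
  The substitution \<open>\<tau> = 1/2 + arctan t / pi\<close> turns arc length on the circle into the Cauchy density on
  the line, and the point of the circle into the inverse Cayley transform of \<open>t\<close>.
\<close>
lemma circlepath_conv_line:
  "circlepath 0 1 (1/2 + arctan t / pi) = (of_real t - \<i>) / (of_real t + \<i>)"
proof -
  have nz: "of_real t + \<i> \<noteq> 0" "1 + \<i> * of_real t \<noteq> 0"  "1 - \<i> * of_real t \<noteq> 0" by (auto simp: complex_eq_iff)
  have c: "cos (arctan t) \<noteq> 0" by (simp add: cos_arctan_not_zero)
  have e: "exp (\<i> * of_real (arctan t)) = of_real (cos (arctan t)) * (1 + \<i> * of_real t)"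
    using c tan_arctan[of t] by (simp add: exp_Euler tan_def flip: cos_of_real sin_of_real) (simp add: complex_eq_iff field_simps cos_of_real sin_of_real)
  have e': "exp (- (\<i> * of_real (arctan t))) = of_real (cos (arctan t)) * (1 - \<i> * of_real t)"
  proof -
    have "exp (- (\<i> * of_real (arctan t))) = cnj (exp (\<i> * of_real (arctan t)))" by (simp add: exp_cnj)
    then show ?thesis by (simp add: e)
  qed
  have "circlepath 0 1 (1/2 + arctan t / pi) = exp (of_real pi * \<i> + 2 * (\<i> * of_real (arctan t)))"
    by (simp add: circlepath algebra_simps)
  also have "\<dots> = - exp (2 * (\<i> * of_real (arctan t)))" by (simp add: exp_add mult.commute[of _ \<i>])
  also have "exp (2 * (\<i> * of_real (arctan t))) = exp (\<i> * of_real (arctan t)) / exp (- (\<i> * of_real (arctan t)))"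
    by (simp add: exp_minus field_simps flip: exp_add)
  also have "\<dots> = (1 + \<i> * of_real t) / (1 - \<i> * of_real t)"
    unfolding e e' using c by simp
  also have "- \<dots> = (of_real t - \<i>) / (of_real t + \<i>)"
    using nz by (simp add: field_simps)
  finally show ?thesis .
qed

lemma arctan_image: "(\<lambda>t. 1/2 + arctan t / pi) ` UNIV = {0<..<1}"
proof (intro equalityI subsetI)
  fix x assume "x \<in> (\<lambda>t. 1/2 + arctan t / pi) ` UNIV"
  then obtain t where "x = 1/2 + arctan t / pi" by blast
  moreover have "- (1/2) < arctan t / pi" "arctan t / pi < 1/2"
    using arctan_bounded[of t] by (simp_all add: pos_less_divide_eq pos_divide_less_eq)
  ultimately show "x \<in> {0<..<1}" unfolding greaterThanLessThan_iff by linarith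
next
  fix x :: real assume x: "x \<in> {0<..<1}"
  have "arctan (tan (pi * (x - 1/2))) = pi * (x - 1/2)"
  proof (rule arctan_tan)
    have "0 < pi * x" "pi * x < pi" using x by auto
    then show "- (pi / 2) < pi * (x - 1 / 2)" "pi * (x - 1 / 2) < pi / 2" by (simp_all add: algebra_simps)
  qed
  then show "x \<in> (\<lambda>t. 1/2 + arctan t / pi) ` UNIV" by (intro image_eqI[of _ _ "tan (pi * (x - 1/2))"]) auto
qed

lemma norm_line: "norm (of_real t - \<i>) = norm (of_real t + \<i>)"
  by (simp add: cmod_def)

lemma circle_mean_conv_line:
  fixes u :: "complex \<Rightarrow> real"
  assumes "continuous_on (sphere 0 1) u"
  shows "integrable lborel (\<lambda>t. u ((of_real t - \<i>) / (of_real t + \<i>)) / (1 + t\<^sup>2))"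
    and "(LINT t|lborel. u ((of_real t - \<i>) / (of_real t + \<i>)) / (1 + t\<^sup>2)) = pi * integral {0..1} (\<lambda>\<tau>. u (circlepath 0 1 \<tau>))"
proof -
  define f where "f = (\<lambda>\<tau>. u (circlepath 0 1 \<tau>))"
  define g where "g = (\<lambda>t. 1/2 + arctan t / pi)"
  have contf: "continuous_on {0..1} f"
    unfolding f_def by (rule continuous_on_compose2[OF assms]) (auto simp: circlepath intro!: continuous_intros)
  have ae: "f absolutely_integrable_on {0<..<1}"
    using absolutely_integrable_continuous_real[OF contf] 
    by (rule set_integrable_subset) auto
  have int_eq: "integral {0<..<1} f = integral {0..1} f"
    using integral_open_interval[of 0 "1::real" f] by simp
  have "(\<lambda>t. \<bar>1 / (pi * (1 + t\<^sup>2))\<bar> * f (g t)) absolutely_integrable_on UNIV \<and>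
           integral UNIV (\<lambda>t. \<bar>1 / (pi * (1 + t\<^sup>2))\<bar> * f (g t)) = integral {0<..<1} f
     \<longleftrightarrow> f absolutely_integrable_on (g ` UNIV) \<and> integral (g ` UNIV) f = integral {0<..<1} f"
  proof (rule has_absolute_integral_change_of_variables_1')
    show "(g has_field_derivative 1 / (pi * (1 + t\<^sup>2))) (at t)" for t
      unfolding g_def by (auto intro!: derivative_eq_intros simp: divide_simps)
    show "inj g" unfolding g_def by (auto intro!: injI simp: arctan_eq_iff)
  qed auto
  then have *: "(\<lambda>t. \<bar>1 / (pi * (1 + t\<^sup>2))\<bar> * f (g t)) absolutely_integrable_on UNIV"
    "integral UNIV (\<lambda>t. \<bar>1 / (pi * (1 + t\<^sup>2))\<bar> * f (g t)) = integral {0..1} f"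
    using ae int_eq unfolding g_def arctan_image by auto
  have eq: "(\<lambda>t. \<bar>1 / (pi * (1 + t\<^sup>2))\<bar> * f (g t)) = (\<lambda>t. (1 / pi) * (u ((of_real t - \<i>) / (of_real t + \<i>)) / (1 + t\<^sup>2)))"
    by (rule ext) (simp add: f_def g_def circlepath_conv_line abs_mult)
  have meas: "(\<lambda>t. u ((of_real t - \<i>) / (of_real t + \<i>)) / (1 + t\<^sup>2)) \<in> borel_measurable borel"
  proof (intro borel_measurable_continuous_onI continuous_intros continuous_on_compose2[OF assms])
    have nz: "of_real t + \<i> \<noteq> 0" for t by (auto simp: complex_eq_iff)
    then show "\<forall>x\<in>UNIV. complex_of_real x + \<i> \<noteq> 0" by blast
    show "(\<lambda>x. (complex_of_real x - \<i>) / (complex_of_real x + \<i>)) ` UNIV \<subseteq> sphere 0 1"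
      using nz norm_line by (auto simp: norm_divide)
    show "\<forall>x\<in>UNIV. 1 + x\<^sup>2 \<noteq> (0::real)" by (metis add_pos_nonneg less_irrefl zero_le_power2 zero_less_one)
  qed
  have "integrable lebesgue (\<lambda>t. (1 / pi) * (u ((of_real t - \<i>) / (of_real t + \<i>)) / (1 + t\<^sup>2)))"
    using *(1) unfolding eq set_integrable_def by simp
  then have "integrable lebesgue (\<lambda>t. u ((of_real t - \<i>) / (of_real t + \<i>)) / (1 + t\<^sup>2))"
    by (subst (asm) integrable_mult_left_iff) auto
  then show int: "integrable lborel (\<lambda>t. u ((of_real t - \<i>) / (of_real t + \<i>)) / (1 + t\<^sup>2))"
    using meas by (subst (asm) integrable_completion) auto
  have "(LINT t|lborel. (1 / pi) * (u ((of_real t - \<i>) / (of_real t + \<i>)) / (1 + t\<^sup>2))) = integral {0..1} f"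
    by (rule trans[OF integral_lborel[OF integrable_mult_right[OF int], symmetric] *(2)[unfolded eq]])
  then have "(1 / pi) * (LINT t|lborel. u ((of_real t - \<i>) / (of_real t + \<i>)) / (1 + t\<^sup>2)) = integral {0..1} f"
    unfolding integral_mult_right_zero .
  then show "(LINT t|lborel. u ((of_real t - \<i>) / (of_real t + \<i>)) / (1 + t\<^sup>2)) = pi * integral {0..1} (\<lambda>\<tau>. u (circlepath 0 1 \<tau>))"
    by (simp add: f_def divide_eq_eq mult.commute)
qed

lemma Cauchy_density:
  "integrable lborel (\<lambda>t::real. 1 / (1 + t\<^sup>2))" "(LINT t|lborel. 1 / (1 + t\<^sup>2)) = pi"
  using circle_mean_conv_line[of "\<lambda>_. 1"] by auto

text \<open>
  The biholomorphic map from the unit disc to the upper half-plane that takes 0 to \<open>\<i>\<close> and 1 to infinity.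
\<close>
definition cayley :: "complex \<Rightarrow> complex" where
  "cayley \<zeta> = \<i> * (1 + \<zeta>) / (1 - \<zeta>)"

lemma cayley_0 [simp]: "cayley 0 = \<i>" by (simp add: cayley_def)

lemma cayley_line: "cayley ((of_real t - \<i>) / (of_real t + \<i>)) = of_real t"
proof -
  have nz: "of_real t + \<i> \<noteq> 0" by (auto simp: complex_eq_iff)
  then show ?thesis unfolding cayley_def by (simp add: field_simps)
qed

lemma Im_cayley: "Im (cayley \<zeta>) = (1 - norm \<zeta>^2) / norm (1 - \<zeta>)^2"
  unfolding cayley_def Im_divide cmod_power2
  by (simp add: algebra_simps power2_eq_square)

lemma Im_cayley_pos: "norm \<zeta> < 1 \<Longrightarrow> Im (cayley \<zeta>) > 0"
proof -
  assume a: "norm \<zeta> < 1"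
  then have "1 - \<zeta> \<noteq> 0" by auto
  moreover have "norm \<zeta>^2 < 1" using a by (simp add: power_less_one_iff)
  ultimately show ?thesis unfolding Im_cayley by simp
qed

lemma cayley_holomorphic: "cayley holomorphic_on ball 0 1"
  unfolding cayley_def by (intro holomorphic_intros) auto

text \<open>
  The hypothesis \<open>sub\<close> is the sub-mean value property of \<open>u\<close> after transport to the disc, on circles of radius
  \<open>r < 1\<close>. As \<open>r\<close> tends to 1 these circles fill out the whole real line, and boundedness of \<open>u\<close> lets the mean
  pass to the limit: the missing boundary point at infinity carries no mass. Both powers of moduli
  and imaginary parts of holomorphic functions are admissible.
\<close>
lemma half_plane_poisson_submean:
  fixes u :: "complex \<Rightarrow> real"
  assumes cont: "continuous_on {z. Im z \<ge> 0} u"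
    and bdd: "\<And>z. Im z \<ge> 0 \<Longrightarrow> \<bar>u z\<bar> \<le> B"
    and sub: "\<And>r. 0 < r \<Longrightarrow> r < 1 \<Longrightarrow> u \<i> \<le> integral {0..1} (\<lambda>\<tau>. u (cayley (of_real r * circlepath 0 1 \<tau>)))"
  shows "integrable lborel (\<lambda>t. u (of_real t) / (1 + t\<^sup>2))"
    and "pi * u \<i> \<le> (LINT t|lborel. u (of_real t) / (1 + t\<^sup>2))"
proof -
  define m where "m = (\<lambda>t::real. (of_real t - \<i>) / (of_real t + \<i>))"
  have nz: "of_real t + \<i> \<noteq> 0" for t by (auto simp: complex_eq_iff)
  have nm: "norm (m t) = 1" for t unfolding m_def using nz[of t] norm_line[of t] by (simp add: norm_divide)
  have m1: "m t \<noteq> 1" for t 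
  proof
    assume "m t = 1"
    then have "of_real t - \<i> = of_real t + \<i>" using nz[of t] by (simp add: m_def)
    then show False by (simp add: complex_eq_iff)
  qed
  define rr where "rr = (\<lambda>n::nat. 1 - 1 / (real n + 2))"
  have rr: "0 < rr n" "rr n < 1" for n by (auto simp: rr_def field_simps)
  have rrlim: "rr \<longlonglongrightarrow> 1" unfolding rr_def by real_asymp
  have ic: "Im (cayley (of_real (rr n) * m t)) > 0" for n t
    by (rule Im_cayley_pos) (use rr[of n] nm in \<open>simp add: norm_mult\<close>)
  have contn: "continuous_on (sphere 0 1) (\<lambda>\<zeta>. u (cayley (of_real (rr n) * \<zeta>)))" for n
  proof (rule continuous_on_compose2[OF cont])
    have *: "of_real (rr n) * \<zeta> \<in> ball 0 1" if "\<zeta> \<in> sphere 0 1" for \<zeta> :: complex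
      using that rr[of n] by (simp add: norm_mult)
    show "continuous_on (sphere 0 1) (\<lambda>\<zeta>. cayley (of_real (rr n) * \<zeta>))"
      by (rule continuous_on_compose2[OF holomorphic_on_imp_continuous_on[OF cayley_holomorphic]]) 
        (use * in \<open>auto intro!: continuous_intros\<close>)
    show "(\<lambda>\<zeta>. cayley (of_real (rr n) * \<zeta>)) ` sphere 0 1 \<subseteq> {z. 0 \<le> Im z}"
    proof (intro image_subsetI CollectI less_imp_le Im_cayley_pos)
      fix \<zeta> :: complex assume "\<zeta> \<in> sphere 0 1"
      from *[OF this] show "norm (of_real (rr n) * \<zeta>) < 1" unfolding mem_ball_0 .
    qed
  qed
  have line: "integrable lborel (\<lambda>t. u (cayley (of_real (rr n) * m t)) / (1 + t\<^sup>2))"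
    "(LINT t|lborel. u (cayley (of_real (rr n) * m t)) / (1 + t\<^sup>2)) = pi * integral {0..1} (\<lambda>\<tau>. u (cayley (of_real (rr n) * circlepath 0 1 \<tau>)))" for n
    using circle_mean_conv_line[OF contn[of n]] by (auto simp: m_def)
  have lim: "(\<lambda>n. u (cayley (of_real (rr n) * m t)) / (1 + t\<^sup>2)) \<longlonglongrightarrow> u (of_real t) / (1 + t\<^sup>2)" for t
  proof -
    have "(\<lambda>n. cayley (of_real (rr n) * m t)) \<longlonglongrightarrow> cayley (of_real 1 * m t)"
      unfolding cayley_def using m1[of t] by (intro tendsto_intros rrlim) auto
    then have l: "(\<lambda>n. cayley (of_real (rr n) * m t)) \<longlonglongrightarrow> of_real t"
      by (simp add: m_def cayley_line)
    have "(\<lambda>n. u (cayley (of_real (rr n) * m t))) \<longlonglongrightarrow> u (of_real t)"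
      by (rule continuous_on_tendsto_compose[OF cont l]) (use ic in \<open>auto intro!: always_eventually less_imp_le\<close>)
    moreover have "1 + t\<^sup>2 \<noteq> 0" by (metis add_pos_nonneg less_irrefl zero_le_power2 zero_less_one)
    ultimately show ?thesis by (intro tendsto_intros)
  qed
  have mu: "(\<lambda>t. u (of_real t) / (1 + t\<^sup>2)) \<in> borel_measurable lborel"
  proof -
    have "continuous_on UNIV (\<lambda>t. u (of_real t))" 
      by (rule continuous_on_compose2[OF cont]) (auto intro!: continuous_intros)
    then have [measurable]: "(\<lambda>t. u (of_real t)) \<in> borel_measurable borel" by (rule borel_measurable_continuous_onI)
    show ?thesis by measurable
  qed
  have bound: "norm (u (cayley (of_real (rr n) * m t)) / (1 + t\<^sup>2)) \<le> B * (1 / (1 + t\<^sup>2))" for n t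
    using bdd[OF less_imp_le[OF ic[of n t]]] by (simp add: divide_right_mono add_nonneg_nonneg)
  have dom: "integrable lborel (\<lambda>t. B * (1 / (1 + t\<^sup>2)))" using Cauchy_density(1) by (rule integrable_mult_right)
  have ms: "(\<lambda>t. u (cayley (of_real (rr n) * m t)) / (1 + t\<^sup>2)) \<in> borel_measurable lborel" for n
    using borel_measurable_integrable[OF line(1)] .
  have lim': "AE t in lborel. (\<lambda>n. u (cayley (of_real (rr n) * m t)) / (1 + t\<^sup>2)) \<longlonglongrightarrow> u (of_real t) / (1 + t\<^sup>2)"
    using lim by simp
  have bound': "AE t in lborel. norm (u (cayley (of_real (rr n) * m t)) / (1 + t\<^sup>2)) \<le> B * (1 / (1 + t\<^sup>2))" for n
    using bound by (intro AE_I2)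
  show "integrable lborel (\<lambda>t. u (of_real t) / (1 + t\<^sup>2))"
    by (rule integrable_dominated_convergence[OF mu ms dom lim' bound'])
  have "(\<lambda>n. LINT t|lborel. u (cayley (of_real (rr n) * m t)) / (1 + t\<^sup>2)) \<longlonglongrightarrow> (LINT t|lborel. u (of_real t) / (1 + t\<^sup>2))"
    by (rule integral_dominated_convergence[OF mu ms dom lim' bound'])
  moreover have "pi * u \<i> \<le> (LINT t|lborel. u (cayley (of_real (rr n) * m t)) / (1 + t\<^sup>2))" for n
    unfolding line(2) using sub[OF rr] by (intro mult_left_mono) auto
  ultimately show "pi * u \<i> \<le> (LINT t|lborel. u (of_real t) / (1 + t\<^sup>2))"
    by (intro LIMSEQ_le_const) auto
qed

section \<open>Schwarz--Pick and Julia--Wolff--Caratheodory in the half-plane\<close>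

lemma upper_half_planeI: "Im z > 0 \<Longrightarrow> z \<in> upper_half_plane"
  by (simp add: upper_half_plane_def)

lemma open_upper_half_plane: "open upper_half_plane"
  unfolding upper_half_plane_def by (rule open_halfspace_Im_gt)

lemma pseudo_hyperbolic_gap:
  "norm (z - cnj a)^2 - norm (z - a)^2 = 4 * Im z * Im a"
  unfolding cmod_power2 by (simp add: algebra_simps power2_eq_square)

lemma pseudo_hyperbolic_less_1:
  assumes "Im z > 0" "Im a > 0"
  shows "norm ((z - a) / (z - cnj a)) < 1" "z - cnj a \<noteq> 0"
proof -
  have "norm (z - a)^2 < norm (z - cnj a)^2"
    using pseudo_hyperbolic_gap[of z a] assms by (smt (verit) mult_pos_pos)
  then have l: "norm (z - a) < norm (z - cnj a)" by (rule power2_less_imp_less) simp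
  then show "z - cnj a \<noteq> 0" by auto
  then show "norm ((z - a) / (z - cnj a)) < 1" using l by (simp add: norm_divide)
qed

text \<open>
  Moving \<open>a\<close> and \<open>H a\<close> to the origin by Cayley-type maps reduces this to the Schwarz lemma. The form without
  denominators still makes sense when \<open>H\<close> takes real values, which is what the Julia-Wolff
  argument meets.
\<close>
lemma Schwarz_Pick_strict:
  assumes hol: "H holomorphic_on upper_half_plane" and pos: "\<And>z. Im z > 0 \<Longrightarrow> Im (H z) > 0"
    and z: "Im z > 0" and a: "Im a > 0"
  shows "norm (H z - H a)^2 * Im z * Im a \<le> norm (z - a)^2 * Im (H z) * Im (H a)"
proof -
  define b where "b = H a"
  have b: "Im b > 0" unfolding b_def using pos a by simp
  define T where "T = (\<lambda>\<zeta>. (a - cnj a * \<zeta>) / (1 - \<zeta>))"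
  have TU: "T \<zeta> \<in> upper_half_plane" if "norm \<zeta> < 1" for \<zeta>
  proof -
    have n: "1 - \<zeta> \<noteq> 0" using that by auto
    have "Im (T \<zeta>) = Im a * (1 - norm \<zeta>^2) / norm (1 - \<zeta>)^2"
      unfolding T_def Im_divide cmod_power2 by (simp add: algebra_simps power2_eq_square)
    moreover have "norm \<zeta>^2 < 1" using that by (simp add: power_less_one_iff)
    ultimately show ?thesis using n a by (simp add: upper_half_plane_def)
  qed
  have Thol: "T holomorphic_on ball 0 1" unfolding T_def by (intro holomorphic_intros) auto
  define K where "K = (\<lambda>\<zeta>. (H (T \<zeta>) - b) / (H (T \<zeta>) - cnj b))"
  have HT: "(\<lambda>\<zeta>. H (T \<zeta>)) holomorphic_on ball 0 1"
    by (rule holomorphic_on_compose_gen[OF Thol hol, unfolded o_def]) (use TU in auto)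
  have imHT: "Im (H (T \<zeta>)) > 0" if "norm \<zeta> < 1" for \<zeta>
    using pos TU[OF that] by (simp add: upper_half_plane_def)
  have "K holomorphic_on ball 0 1" unfolding K_def
    by (intro holomorphic_intros HT) (use imHT b pseudo_hyperbolic_less_1(2) in auto)
  moreover have "K 0 = 0" by (simp add: K_def T_def b_def)
  moreover have "norm (K \<zeta>) < 1" if "norm \<zeta> < 1" for \<zeta>
    unfolding K_def using imHT[OF that] b by (rule pseudo_hyperbolic_less_1(1))
  ultimately have SL: "norm (K \<zeta>) \<le> norm \<zeta>" if "norm \<zeta> < 1" for \<zeta>
    using Schwarz_Lemma(1)[of K \<zeta>] that by blast
  define \<zeta> where "\<zeta> = (z - a) / (z - cnj a)"
  have \<zeta>: "norm \<zeta> < 1" and nz: "z - cnj a \<noteq> 0"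
    unfolding \<zeta>_def using pseudo_hyperbolic_less_1[OF z a] by auto
  have Tz: "T \<zeta> = z"
  proof -
    have n1: "a - cnj a \<noteq> 0" using a by (auto simp: complex_eq_iff)
    have "1 - \<zeta> = (a - cnj a) / (z - cnj a)" unfolding \<zeta>_def using nz by (simp add: field_simps)
    moreover have "a - cnj a * \<zeta> = z * (a - cnj a) / (z - cnj a)" 
      unfolding \<zeta>_def using nz by (simp add: field_simps)
    ultimately show ?thesis unfolding T_def using nz n1 by simp
  qed
  define w where "w = H z"
  have w: "Im w > 0" unfolding w_def using pos z by simp
  have nw: "w - cnj b \<noteq> 0" using pseudo_hyperbolic_less_1(2)[OF w b] .
  have "norm ((w - b) / (w - cnj b)) \<le> norm ((z - a) / (z - cnj a))"
    using SL[OF \<zeta>] unfolding K_def Tz by (simp add: w_def \<zeta>_def)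
  then have "norm (w - b) * norm (z - cnj a) \<le> norm (z - a) * norm (w - cnj b)"
    using nz nw by (simp add: norm_divide divide_simps mult_ac)
  then have sq: "(norm (w - b) * norm (z - cnj a))^2 \<le> (norm (z - a) * norm (w - cnj b))^2"
    by (rule power_mono) simp
  have "norm (w - b)^2 * (norm (z - a)^2 + 4 * Im z * Im a) \<le> norm (z - a)^2 * (norm (w - b)^2 + 4 * Im w * Im b)"
    
  proof -
    have "norm (z - cnj a)^2 = norm (z - a)^2 + 4 * Im z * Im a" "norm (w - cnj b)^2 = norm (w - b)^2 + 4 * Im w * Im b"
      using pseudo_hyperbolic_gap[of z a] pseudo_hyperbolic_gap[of w b] by linarith+
    with sq show ?thesis by (simp only: power_mult_distrib)
  qed
  then show ?thesis by (simp add: w_def b_def algebra_simps)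
qed

lemma Schwarz_Pick:
  assumes hol: "H holomorphic_on upper_half_plane" and nn: "\<And>z. Im z > 0 \<Longrightarrow> Im (H z) \<ge> 0"
    and z: "Im z > 0" and a: "Im a > 0"
  shows "norm (H z - H a)^2 * Im z * Im a \<le> norm (z - a)^2 * Im (H z) * Im (H a)"
proof (rule tendsto_lowerbound)
  show "((\<lambda>e. norm (z - a)^2 * (Im (H z) + e) * (Im (H a) + e)) \<longlongrightarrow> norm (z - a)^2 * Im (H z) * Im (H a)) (at_right 0)"
    by (auto intro!: tendsto_eq_intros)
  show "eventually (\<lambda>e. norm (H z - H a)^2 * Im z * Im a \<le> norm (z - a)^2 * (Im (H z) + e) * (Im (H a) + e)) (at_right 0)"
    using eventually_at_right_less
  proof eventually_elim
    case (elim e)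
    have "norm ((H z + \<i> * of_real e) - (H a + \<i> * of_real e))^2 * Im z * Im a 
      \<le> norm (z - a)^2 * Im (H z + \<i> * of_real e) * Im (H a + \<i> * of_real e)"
      by (rule Schwarz_Pick_strict[of "\<lambda>z. H z + \<i> * of_real e"])
         (use elim nn z a in \<open>auto intro!: holomorphic_intros hol add_nonneg_pos\<close>)
    then show ?case by simp
  qed
qed simp

lemma sector_norm_le:
  assumes "z \<in> sector_infinity u" "u > 0"
  shows "Im z > 0" "norm z \<le> (1 + u) * Im z"
proof -
  show "Im z > 0" using assms by (simp add: sector_infinity_def upper_half_plane_def)
  then show "norm z \<le> (1 + u) * Im z"
    using assms cmod_le[of z] by (simp add: sector_infinity_def algebra_simps)
qed

lemma nontangential_limit_iff:
  "nontangential_limit f c \<longleftrightarrow> 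
     (\<forall>u>0. \<forall>e>0. \<exists>R>0. \<forall>z\<in>sector_infinity u. norm z \<ge> R \<longrightarrow> norm (f z - c) < e)"
proof -
  have "(f \<longlongrightarrow> c) (inf at_infinity (principal S)) \<longleftrightarrow> (\<forall>e>0. \<exists>R>0. \<forall>z\<in>S. norm z \<ge> R \<longrightarrow> norm (f z - c) < e)" for S
    unfolding tendsto_iff eventually_inf_principal eventually_at_infinity_pos dist_norm by blast
  then show ?thesis unfolding nontangential_limit_def by simp
qed

text \<open>
  Pick a point \<open>a\<close> where \<open>Im (H a)\<close> is small compared with \<open>Im a\<close>. Schwarz--Pick against this point gives
  \<open>norm (H z - H a)^2 \<le> k * norm (z - a)^2 / Im z * Im (H z)\<close>, and in a sector the right side is at most a
  small multiple of \<open>norm z * norm (H z)\<close>. A quadratic inequality of this form forces \<open>H z\<close> to be small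
  compared with \<open>z\<close>.
\<close>
lemma Julia_Wolff_vanishing:
  assumes hol: "H holomorphic_on upper_half_plane" and nn: "\<And>z. Im z > 0 \<Longrightarrow> Im (H z) \<ge> 0"
    and inf: "\<And>e. e > 0 \<Longrightarrow> \<exists>z. Im z > 0 \<and> Im (H z) \<le> e * Im z"
  shows "nontangential_limit (\<lambda>z. H z / z) 0"
  unfolding nontangential_limit_iff
proof (intro allI impI)
  fix u e :: real assume u: "u > 0" and e: "e > 0"
  \<comment> \<open>\<open>1 + u\<close> is the loss from \<open>norm z\<close> to \<open>Im z\<close> in the sector; the rest absorbs the quadratic inequality\<close>
  define k where "k = e^2 / (64 * (1 + e)) / (1 + u)"
  have k: "k > 0" unfolding k_def using u e by simp
  obtain a where a: "Im a > 0" "Im (H a) \<le> k * Im a" using inf[OF k] by blast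
  define B where "B = norm (H a)"
  have B: "B \<ge> 0" by (simp add: B_def)
  \<comment> \<open>beyond \<open>R\<close> the base point \<open>a\<close> and its value are negligible\<close>
  define R where "R = 1 + norm a + B + 4 * B / e"
  have R: "R \<ge> 1" "R \<ge> norm a" "R \<ge> B" "e * R \<ge> 4 * B" 
    unfolding R_def using B e by (auto simp: field_simps intro!: add_nonneg_nonneg)
  show "\<exists>R>0. \<forall>z\<in>sector_infinity u. R \<le> norm z \<longrightarrow> norm (H z / z - 0) < e"
  proof (intro exI conjI ballI impI)
    show "R > 0" using R by simp
    fix z assume z: "z \<in> sector_infinity u" "R \<le> norm z"
    note zs = sector_norm_le[OF z(1) u]
    define D where "D = norm (H z - H a)"
    have D0: "D \<ge> 0" by (simp add: D_def)
    have za: "norm (z - a) \<le> 2 * norm z" using norm_triangle_ineq4[of z a] R z by linarith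
    have "norm (H z) \<le> D + B" unfolding D_def B_def by (metis add.commute norm_triangle_sub)
    then have imH: "Im (H z) \<le> D + B" using abs_Im_le_cmod[of "H z"] by linarith
    have "D^2 * Im z * Im a \<le> norm (z - a)^2 * Im (H z) * Im (H a)"
      unfolding D_def by (rule Schwarz_Pick[OF hol nn zs(1) a(1)])
    also have "\<dots> \<le> (2 * norm z)^2 * (D + B) * (k * Im a)"
      by (intro mult_mono power_mono za imH a) (use nn a zs D0 B in auto)
    finally have "(D^2 * Im z) * Im a \<le> ((2 * norm z)^2 * (D + B) * k) * Im a" by (simp add: mult_ac)
    then have "D^2 * Im z \<le> (2 * norm z)^2 * (D + B) * k" using a(1) by simp
    then have "D^2 * Im z * (1 + u) \<le> (2 * norm z)^2 * (D + B) * k * (1 + u)" using u by (simp add: mult_right_mono)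
    moreover have "D^2 * norm z \<le> D^2 * ((1 + u) * Im z)" using zs by (intro mult_left_mono) auto
    ultimately have "D^2 * norm z \<le> (4 * norm z * (D + B) * k * (1 + u)) * norm z" by (simp add: power2_eq_square mult_ac)
    moreover have zp: "norm z > 0" using R z by linarith
    ultimately have D2: "D^2 \<le> 4 * norm z * (D + B) * k * (1 + u)" by (rule mult_right_le_imp_le)
    have "1 + u \<noteq> 0" using u by linarith
    then have "k * (1 + u) = e^2 / (64 * (1 + e))" unfolding k_def by (rule nonzero_eq_divide_eq[THEN iffD1]) (rule refl)
    then have "4 * k * (1 + u) = 4 * (e^2 / (64 * (1 + e)))" by (simp only: mult.assoc)
    also have "\<dots> = e^2 / (16 * (1 + e))" using e by (simp add: divide_simps)
    finally have "4 * k * (1 + u) = e^2 / (16 * (1 + e))" .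
    moreover have "4 * norm z * (D + B) * k * (1 + u) = norm z * (D + B) * (4 * k * (1 + u))" by simp
    ultimately have D3: "D^2 \<le> norm z * (D + B) * (e^2 / (16 * (1 + e)))" using D2 by (simp only:)
    have "D < e / 2 * norm z"
    proof (rule ccontr)
      assume "\<not> D < e / 2 * norm z"
      then have D4: "e * norm z \<le> 2 * D" by simp
      have "e * R \<le> e * norm z" using z e by (intro mult_left_mono) auto
      then have BD: "B \<le> D" using R D4 B by linarith
      have "D > 0" using D4 mult_pos_pos[OF e zp] by linarith
      have "e^2 / (16 * (1 + e)) \<le> e / 16" using e by (simp add: field_simps power2_eq_square)
      then have "norm z * (D + B) * (e^2 / (16 * (1 + e))) \<le> norm z * (D + D) * (e / 16)"
        using BD zp D0 B e by (intro mult_mono) auto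
      also have "\<dots> = (e * norm z) * D / 8" by simp
      also have "\<dots> \<le> 2 * D * D / 8" using D4 D0 by (intro divide_right_mono mult_right_mono) auto
      also have "\<dots> < D^2" using \<open>D > 0\<close> by (simp add: power2_eq_square)
      finally show False using D3 by linarith
    qed
    moreover have "B \<le> e / 4 * norm z"
    proof -
      have "e * R \<le> e * norm z" using z e by (intro mult_left_mono) auto
      then show ?thesis using R by simp
    qed
    ultimately have "norm (H z) < e / 2 * norm z + e / 4 * norm z" using \<open>norm (H z) \<le> D + B\<close> by linarith
    also have "\<dots> \<le> e * norm z" using e zp by simp
    finally show "norm (H z / z - 0) < e" using zp by (simp add: norm_divide pos_divide_less_eq)
  qed
qed

text \<open>
  Subtracting \<open>\<kappa> * z\<close>, with \<open>\<kappa>\<close> the infimum of \<open>Im (H z) / Im z\<close>, leaves a map with infimum zero.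
\<close>
lemma Julia_Wolff_Caratheodory:
  assumes hol: "H holomorphic_on upper_half_plane" and ge: "\<And>z. Im z > 0 \<Longrightarrow> Im (H z) \<ge> \<kappa> * Im z"
    and inf: "\<And>e. e > \<kappa> \<Longrightarrow> \<exists>z. Im z > 0 \<and> Im (H z) \<le> e * Im z"
  shows "nontangential_limit (\<lambda>z. H z / z) (of_real \<kappa>)"
proof -
  have "nontangential_limit (\<lambda>z. (H z - of_real \<kappa> * z) / z) 0"
  proof (rule Julia_Wolff_vanishing)
    show "(\<lambda>z. H z - of_real \<kappa> * z) holomorphic_on upper_half_plane" by (intro holomorphic_intros hol)
    show "Im (H z - of_real \<kappa> * z) \<ge> 0" if "Im z > 0" for z using ge[OF that] by simp
    fix e :: real assume "e > 0"
    then obtain z where "Im z > 0 \<and> Im (H z) \<le> (\<kappa> + e) * Im z" using inf[of "\<kappa> + e"] by auto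
    then show "\<exists>z. Im z > 0 \<and> Im (H z - of_real \<kappa> * z) \<le> e * Im z" by (auto simp: algebra_simps)
  qed
  moreover have "(H z - of_real \<kappa> * z) / z - 0 = H z / z - of_real \<kappa>" if "z \<in> sector_infinity u" for z u
  proof -
    have "z \<noteq> 0" using that by (auto simp: sector_infinity_def upper_half_plane_def)
    then show ?thesis by (simp add: field_simps)
  qed
  ultimately show ?thesis unfolding nontangential_limit_iff by simp
qed

lemma nontangential_limit_imaginary_axis:
  assumes "nontangential_limit f c"
  shows "((\<lambda>y. f (\<i> * of_real y)) \<longlongrightarrow> c) at_top"
proof -
  have "filterlim (\<lambda>y. \<i> * of_real y) (inf at_infinity (principal (sector_infinity 1))) at_top"
    unfolding filterlim_inf filterlim_principal filterlim_at_infinity[OF order_refl] 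
  proof (intro conjI allI impI)
    show "eventually (\<lambda>y. \<i> * complex_of_real y \<in> sector_infinity 1) at_top"
      using eventually_gt_at_top[of 0] by eventually_elim (simp add: sector_infinity_def upper_half_plane_def)
    show "eventually (\<lambda>y. r \<le> norm (\<i> * complex_of_real y)) at_top" for r
      using eventually_ge_at_top[of r] by eventually_elim (simp add: norm_mult)
  qed
  moreover have "(f \<longlongrightarrow> c) (inf at_infinity (principal (sector_infinity 1)))"
    using assms unfolding nontangential_limit_def by simp
  ultimately show ?thesis by (rule filterlim_compose[rotated])
qed

section \<open>Quotient and derivative at infinity\<close>

text \<open>
  Around a point \<open>z\<close> of a sector there is a disc of radius proportional to \<open>norm z\<close> inside a wider sector, on
  which \<open>G w - c * w\<close> is small compared with \<open>z\<close>. Cauchy's estimate then bounds \<open>deriv G z - c\<close>.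
\<close>
lemma nontangential_limit_deriv:
  assumes hol: "G holomorphic_on upper_half_plane" and lim: "nontangential_limit (\<lambda>z. G z / z) c"
  shows "nontangential_limit (deriv G) c"
  unfolding nontangential_limit_iff
proof (intro allI impI)
  fix u e :: real assume u: "u > 0" and e: "e > 0"
  define k where "k = 1 / (2 * (1 + u))"
  have k: "0 < k" "k \<le> 1/2" unfolding k_def using u by (auto simp: field_simps)
  \<comment> \<open>moving \<open>z\<close> by at most \<open>Im z / 2\<close> may halve \<open>Im z\<close> and add \<open>Im z / 2\<close> to the real part\<close>
  define v where "v = 2 * u + 2"
  define d where "d = e * k / 3"
  have d: "d > 0" using e k by (simp add: d_def)
  obtain R where R: "R > 0" "\<And>z. z \<in> sector_infinity v \<Longrightarrow> norm z \<ge> R \<Longrightarrow> norm (G z / z - c) < d"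
  proof -
    have "v > 0" using u by (simp add: v_def)
    from lim[unfolded nontangential_limit_iff, rule_format, OF this d] show ?thesis using that by blast
  qed
  show "\<exists>R>0. \<forall>z\<in>sector_infinity u. R \<le> norm z \<longrightarrow> norm (deriv G z - c) < e"
  proof (intro exI conjI ballI impI)
    show "2 * R > 0" using R by simp
    fix z assume z: "z \<in> sector_infinity u" "2 * R \<le> norm z"
    note zs = sector_norm_le[OF z(1) u]
    define r where "r = k * norm z"
    have zp: "norm z > 0" using R z by linarith
    have r: "r > 0" "r \<le> norm z / 2" using k zp by (auto simp: r_def)
    have r2: "r \<le> Im z / 2"
    proof -
      have "r \<le> k * ((1 + u) * Im z)" unfolding r_def using zs k by (intro mult_left_mono) auto
      also have "\<dots> = Im z / 2" using u unfolding k_def by (simp add: field_simps)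
      finally show ?thesis .
    qed
    have ball: "w \<in> sector_infinity v \<and> R \<le> norm w \<and> norm w \<le> 2 * norm z" if "norm (w - z) \<le> r" for w
    proof -
      have "\<bar>Im (w - z)\<bar> \<le> r" "\<bar>Re (w - z)\<bar> \<le> r" using that abs_Im_le_cmod[of "w - z"] abs_Re_le_cmod[of "w - z"] by linarith+
      then have i: "Im w \<ge> Im z / 2" and ii: "\<bar>Re w\<bar> \<le> \<bar>Re z\<bar> + Im z / 2" using r2 by auto
      have "\<bar>Re z\<bar> < u * Im z" using z by (simp add: sector_infinity_def)
      then have "\<bar>Re w\<bar> < (u + 1/2) * Im z" using ii by (simp add: algebra_simps)
      also have "\<dots> \<le> (u + 1/2) * (2 * Im w)" using i u by (intro mult_left_mono) auto
      also have "\<dots> \<le> v * Im w" using i zs by (simp add: v_def algebra_simps)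
      finally have "w \<in> sector_infinity v" using i zs by (simp add: sector_infinity_def upper_half_plane_def)
      moreover have "norm w \<ge> norm z - r" "norm w \<le> norm z + r" 
        using that norm_triangle_ineq2[of z w] norm_triangle_ineq2[of w z] norm_minus_commute[of z w] by linarith+
      ultimately show ?thesis using r z R by auto
    qed
    have U: "w \<in> upper_half_plane" if "norm (w - z) \<le> r" for w using ball[OF that] by (simp add: sector_infinity_def)
    define F where "F = (\<lambda>w. G w - c * w)"
    have hF: "F holomorphic_on upper_half_plane" unfolding F_def by (intro holomorphic_intros hol)
    have "norm ((deriv ^^ 1) F z) \<le> fact 1 * (d * (2 * norm z)) / r ^ 1"
    proof (rule Cauchy_inequality)
      show "F holomorphic_on ball z r" by (rule holomorphic_on_subset[OF hF]) (use U in \<open>auto simp: dist_norm norm_minus_commute\<close>)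
      show "continuous_on (cball z r) F" 
        by (rule continuous_on_subset[OF holomorphic_on_imp_continuous_on[OF hF]]) (use U in \<open>auto simp: dist_norm norm_minus_commute\<close>)
      show "r > 0" by fact
      fix w assume "norm (z - w) = r"
      then have b: "w \<in> sector_infinity v" "R \<le> norm w" "norm w \<le> 2 * norm z" using ball[of w] by (auto simp: norm_minus_commute)
      have w0: "norm w > 0" using R b by linarith
      have "norm (F w) = norm (G w / w - c) * norm w"
        using w0 unfolding norm_mult[symmetric] by (simp add: F_def algebra_simps)
      also have "\<dots> \<le> d * (2 * norm z)" by (intro mult_mono less_imp_le[OF R(2)] b) (use d in auto)
      finally show "norm (F w) \<le> d * (2 * norm z)" .
    qed
    also have "\<dots> = 2 * e / 3" using zp k by (simp add: r_def d_def)
    also have "(deriv ^^ 1) F z = deriv G z - c"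
    proof -
      have "G field_differentiable at z" 
        using z by (intro holomorphic_on_imp_differentiable_at[OF hol open_upper_half_plane]) (simp add: sector_infinity_def)
      then have "(G has_field_derivative deriv G z) (at z)" by (simp add: DERIV_deriv_iff_field_differentiable)
      then have "(F has_field_derivative deriv G z - c * 1) (at z)"
        unfolding F_def by (intro DERIV_diff DERIV_cmult DERIV_ident)
      then show ?thesis by (simp add: DERIV_imp_deriv)
    qed
    finally show "norm (deriv G z - c) < e" using e by linarith
  qed
qed

text \<open>
  The part of a sector above a horizontal line is convex, so there \<open>G z - c * z\<close> is Lipschitz with a small
  constant.
\<close>
lemma nontangential_limit_quotient:
  assumes hol: "G holomorphic_on upper_half_plane" and lim: "nontangential_limit (deriv G) c"
  shows "nontangential_limit (\<lambda>z. G z / z) c"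
  unfolding nontangential_limit_iff
proof (intro allI impI)
  fix u e :: real assume u: "u > 0" and e: "e > 0"
  obtain R where R: "R > 0" "\<And>z. z \<in> sector_infinity u \<Longrightarrow> norm z \<ge> R \<Longrightarrow> norm (deriv G z - c) < e / 4"
  proof -
    have "e / 4 > 0" using e by simp
    from lim[unfolded nontangential_limit_iff, rule_format, OF u this] show ?thesis using that by blast
  qed
  define S where "S = {z \<in> sector_infinity u. Im z > R}"
  define F where "F = (\<lambda>w. G w - c * w)"
  have "convex (sector_infinity u)"
  proof -
    have "sector_infinity u = {z. Im z > 0} \<inter> {z. inner (Complex 1 (- u)) z < 0} \<inter> {z. inner (Complex (-1) (- u)) z < 0}"
      by (auto simp: sector_infinity_def upper_half_plane_def inner_complex_def abs_less_iff)
    moreover have "convex \<dots>"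
      by (intro convex_Int convex_halfspace_Im_gt convex_halfspace_lt)
    ultimately show ?thesis by (rule ssubst)
  qed
  moreover have "S = sector_infinity u \<inter> {z. Im z > R}" by (auto simp: S_def)
  ultimately have conv: "convex S" using convex_halfspace_Im_gt[of R] by (simp add: convex_Int)
  define a where "a = \<i> * of_real (R + 1)"
  have aS: "a \<in> S" using R u by (simp add: a_def S_def sector_infinity_def upper_half_plane_def)
  have bound: "norm (F z - F a) \<le> e / 4 * norm (z - a)" if "z \<in> S" for z
  proof (rule field_differentiable_bound[OF conv])
    fix w assume w: "w \<in> S"
    then have wU: "w \<in> upper_half_plane" by (simp add: S_def sector_infinity_def)
    have "G field_differentiable at w" 
        using holomorphic_on_imp_differentiable_at[OF hol open_upper_half_plane wU] .
    then have "(G has_field_derivative deriv G w) (at w)" by (simp add: DERIV_deriv_iff_field_differentiable)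
    then have "(F has_field_derivative deriv G w - c * 1) (at w)"
      unfolding F_def by (intro DERIV_diff DERIV_cmult DERIV_ident)
    then have "(F has_field_derivative (deriv G w - c)) (at w)" by simp
    then show "(F has_field_derivative (deriv G w - c)) (at w within S)" by (rule has_field_derivative_at_within)
    have "norm w \<ge> R" using w abs_Im_le_cmod[of w] unfolding S_def mem_Collect_eq by linarith
    then show "norm (deriv G w - c) \<le> e / 4" using w R(2)[of w] by (simp add: S_def)
  qed (use that aS in auto)
  define M where "M = (1 + u) * (R + 1) + 4 * norm (F a) / e + norm a"
  show "\<exists>R>0. \<forall>z\<in>sector_infinity u. R \<le> norm z \<longrightarrow> norm (G z / z - c) < e"
  proof (intro exI conjI ballI impI)
    show M: "M > 0" using R u e unfolding M_def by (intro add_pos_nonneg mult_pos_pos) auto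
    fix z assume z: "z \<in> sector_infinity u" "M \<le> norm z"
    note zs = sector_norm_le[OF z(1) u]
    have nn: "(1 + u) * (R + 1) \<ge> 0" "4 * norm (F a) / e \<ge> 0" "norm a \<ge> 0" using u R e by auto
    have "(1 + u) * (R + 1) \<le> (1 + u) * Im z" using zs z nn unfolding M_def by linarith
    then have "Im z > R" using u by simp
    then have zS: "z \<in> S" using z by (simp add: S_def)
    have zp: "norm z > 0" using M z by linarith
    have za: "norm (z - a) \<le> 2 * norm z" using norm_triangle_ineq4[of z a] z nn unfolding M_def by linarith
    have "norm (F a) * 4 / e \<le> norm z" using z nn unfolding M_def mult.commute[of _ 4] by linarith
    then have Fa: "norm (F a) \<le> e / 4 * norm z" using e by (simp add: field_simps)
    have "norm (F z) \<le> norm (F z - F a) + norm (F a)" by (metis add.commute norm_triangle_sub)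
    also have "\<dots> \<le> e / 4 * (2 * norm z) + e / 4 * norm z"
    proof -
      have "e / 4 * norm (z - a) \<le> e / 4 * (2 * norm z)" using za e by (intro mult_left_mono) auto
      then show ?thesis using bound[OF zS] Fa by linarith
    qed
    also have "\<dots> < e * norm z" using e zp by simp
    finally have "norm (F z) < e * norm z" .
    moreover have "G z / z - c = F z / z" using zp by (auto simp: F_def field_simps)
    ultimately show "norm (G z / z - c) < e" using zp by (simp add: norm_divide pos_divide_less_eq)
  qed
qed

section \<open>Angular derivatives at infinity\<close>

lemma nontangential_limit_real_part:
  assumes "nontangential_limit (\<lambda>z. H z / z) c"
  shows "((\<lambda>y. Im (H (\<i> * of_real y)) / y) \<longlongrightarrow> Re c) at_top"
proof -
  have "((\<lambda>y. Re (H (\<i> * of_real y) / (\<i> * of_real y))) \<longlongrightarrow> Re c) at_top"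
    using nontangential_limit_imaginary_axis[OF assms] by (rule tendsto_Re)
  moreover have "Re (H (\<i> * of_real y) / (\<i> * of_real y)) = Im (H (\<i> * of_real y)) / y" for y
    by (simp add: Re_divide power2_eq_square)
  ultimately show ?thesis by simp
qed

lemma angular_derivative_lower_bound:
  assumes "nontangential_limit (\<lambda>z. H z / z) c" "\<And>z. Im z > 0 \<Longrightarrow> Im (H z) \<ge> b * Im z"
  shows "b \<le> Re c"
proof (rule tendsto_lowerbound[OF nontangential_limit_real_part[OF assms(1)]])
  show "\<forall>\<^sub>F y in at_top. b \<le> Im (H (\<i> * of_real y)) / y"
    using eventually_gt_at_top[of 0]
  proof eventually_elim
    case (elim y)
    then show ?case using assms(2)[of "\<i> * of_real y"] by (simp add: pos_le_divide_eq)
  qed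
qed simp

lemma angular_derivative_exists:
  assumes hol: "H holomorphic_on upper_half_plane" and ge: "\<And>z. Im z > 0 \<Longrightarrow> Im (H z) \<ge> b * Im z"
  obtains \<kappa> where "\<kappa> \<ge> b" "\<And>z. Im z > 0 \<Longrightarrow> Im (H z) \<ge> \<kappa> * Im z" "nontangential_limit (\<lambda>z. H z / z) (of_real \<kappa>)"
proof -
  define A where "A = (\<lambda>z. Im (H z) / Im z) ` upper_half_plane"
  define \<kappa> where "\<kappa> = Inf A"
  have bA: "b \<le> a" if "a \<in> A" for a using that ge by (auto simp: A_def upper_half_plane_def pos_le_divide_eq)
  then have bdd: "bdd_below A" by (rule bdd_belowI)
  have ne: "A \<noteq> {}" by (auto simp: A_def upper_half_plane_def intro!: exI[of _ \<i>])
  have "\<kappa> \<ge> b" unfolding \<kappa>_def using ne bA by (rule cInf_greatest)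
  moreover have g: "Im (H z) \<ge> \<kappa> * Im z" if "Im z > 0" for z
  proof -
    have "\<kappa> \<le> Im (H z) / Im z" unfolding \<kappa>_def using bdd that by (intro cInf_lower) (auto simp: A_def upper_half_plane_def)
    then show ?thesis using that by (simp add: pos_le_divide_eq)
  qed
  moreover have "nontangential_limit (\<lambda>z. H z / z) (of_real \<kappa>)"
  proof (rule Julia_Wolff_Caratheodory[OF hol g])
    fix e assume "e > \<kappa>"
    then obtain a where "a \<in> A" "a < e" unfolding \<kappa>_def using ne cInf_lessD by blast
    then show "\<exists>z. Im z > 0 \<and> Im (H z) \<le> e * Im z"
      by (auto simp: A_def upper_half_plane_def pos_divide_less_eq intro: less_imp_le)
  qed
  ultimately show ?thesis using that by blast
qed

text \<open>
  By the second hypothesis \<open>H2 (\<i> * y)\<close> tends to infinity inside a sector, so the limit of \<open>H1\<close> may be taken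
  along this curve.
\<close>
lemma angular_derivative_compose:
  assumes H1: "nontangential_limit (\<lambda>z. H1 z / z) (of_real \<kappa>1)"
    and H2: "nontangential_limit (\<lambda>z. H2 z / z) (of_real \<kappa>2)" and \<kappa>2: "\<kappa>2 > 0"
    and H12: "nontangential_limit (\<lambda>z. H z / z) (of_real \<kappa>)"
    and eq: "\<And>z. Im z > 0 \<Longrightarrow> H z = H1 (H2 z)"
  shows "\<kappa> = \<kappa>1 * \<kappa>2"
proof -
  define q where "q = (\<lambda>y. H2 (\<i> * of_real y) / (\<i> * of_real y))"
  have q: "(q \<longlongrightarrow> of_real \<kappa>2) at_top" unfolding q_def by (rule nontangential_limit_imaginary_axis[OF H2])
  have ev: "\<forall>\<^sub>F y in at_top. norm (q y - of_real \<kappa>2) < \<kappa>2 / 2"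
    using tendstoD[OF q, of "\<kappa>2 / 2"] \<kappa>2 by (simp add: dist_norm)
  have H2q: "H2 (\<i> * of_real y) = \<i> * of_real y * q y" if "y > 0" for y using that by (simp add: q_def)
  have ev2: "\<forall>\<^sub>F y in at_top. H2 (\<i> * of_real y) \<in> sector_infinity 1 \<and> y * (\<kappa>2 / 2) \<le> norm (H2 (\<i> * of_real y))"
    using ev eventually_gt_at_top[of 0]
  proof eventually_elim
    case (elim y)
    have "\<bar>Re (q y - of_real \<kappa>2)\<bar> < \<kappa>2 / 2" "\<bar>Im (q y - of_real \<kappa>2)\<bar> < \<kappa>2 / 2"
      using elim abs_Re_le_cmod[of "q y - of_real \<kappa>2"] abs_Im_le_cmod[of "q y - of_real \<kappa>2"] by linarith+
    then have r: "Re (q y) > \<kappa>2 / 2" and i: "\<bar>Im (q y)\<bar> < \<kappa>2 / 2"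
      unfolding minus_complex.simps Re_complex_of_real Im_complex_of_real by linarith+
    have "y * \<bar>Im (q y)\<bar> < y * Re (q y)" using r i elim by (intro mult_strict_left_mono) auto
    moreover have "y * Re (q y) > 0" using r \<kappa>2 elim by simp
    ultimately have "H2 (\<i> * of_real y) \<in> sector_infinity 1"
      using elim by (simp add: H2q sector_infinity_def upper_half_plane_def abs_mult)
    moreover have "y * (\<kappa>2 / 2) \<le> y * norm (q y)" 
      using r elim abs_Re_le_cmod[of "q y"] by (intro mult_left_mono) auto
    ultimately show ?case using elim by (simp add: H2q norm_mult)
  qed
  have "filterlim (\<lambda>y. H2 (\<i> * of_real y)) (inf at_infinity (principal (sector_infinity 1))) at_top"
    unfolding filterlim_inf filterlim_principal filterlim_at_infinity[OF order_refl]
  proof (intro conjI allI impI)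
    show "\<forall>\<^sub>F y in at_top. H2 (\<i> * of_real y) \<in> sector_infinity 1" using ev2 by eventually_elim simp
    show "\<forall>\<^sub>F y in at_top. r \<le> norm (H2 (\<i> * of_real y))" for r
      using ev2 eventually_ge_at_top[of "r / (\<kappa>2 / 2)"]
    proof eventually_elim
      case (elim y)
      then have "r \<le> y * (\<kappa>2 / 2)" using \<kappa>2 by (simp add: pos_divide_le_eq)
      then show ?case using elim by linarith
    qed
  qed
  moreover have "((\<lambda>z. H1 z / z) \<longlongrightarrow> of_real \<kappa>1) (inf at_infinity (principal (sector_infinity 1)))"
    using H1 unfolding nontangential_limit_def by simp
  ultimately have "((\<lambda>y. H1 (H2 (\<i> * of_real y)) / H2 (\<i> * of_real y)) \<longlongrightarrow> of_real \<kappa>1) at_top"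
    by (rule filterlim_compose[rotated])
  from tendsto_mult[OF this q]
  have "((\<lambda>y. H1 (H2 (\<i> * of_real y)) / H2 (\<i> * of_real y) * q y) \<longlongrightarrow> of_real \<kappa>1 * of_real \<kappa>2) at_top" .
  moreover have "\<forall>\<^sub>F y in at_top. H1 (H2 (\<i> * of_real y)) / H2 (\<i> * of_real y) * q y = H (\<i> * of_real y) / (\<i> * of_real y)"
    using ev2 eventually_gt_at_top[of 0]
  proof eventually_elim
    case (elim y)
    then have "norm (H2 (\<i> * of_real y)) > 0" using \<kappa>2 by (smt (verit) divide_pos_pos mult_pos_pos)
    then show ?case using elim eq[of "\<i> * of_real y"] by (simp add: q_def)
  qed
  ultimately have "((\<lambda>y. H (\<i> * of_real y) / (\<i> * of_real y)) \<longlongrightarrow> of_real \<kappa>1 * of_real \<kappa>2) at_top"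
    by (rule Lim_transform_eventually)
  from tendsto_unique[OF _ nontangential_limit_imaginary_axis[OF H12] this]
  have "complex_of_real \<kappa> = of_real \<kappa>1 * of_real \<kappa>2" by simp
  then show ?thesis by (metis of_real_eq_iff of_real_mult)
qed

section \<open>Growth and Poisson domination in Hardy spaces\<close>

lemma hardy_line_continuous:
  assumes "f holomorphic_on upper_half_plane" "0 < y" "0 < p"
  shows "continuous_on UNIV (\<lambda>x. norm (f (Complex x y)) powr p)"
proof -
  have "continuous_on UNIV (\<lambda>x. f (Complex x y))"
    by (rule continuous_on_compose2[OF holomorphic_on_imp_continuous_on[OF assms(1)]])
       (use assms in \<open>auto simp: upper_half_plane_def Complex_eq intro!: continuous_intros\<close>)
  then show ?thesis using assms by (intro continuous_on_powr' continuous_intros) auto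
qed

lemma hardy_space_nn_integral_le:
  assumes f: "f \<in> hardy_space p" and y: "0 < y" and p: "0 < p"
  shows "(\<integral>\<^sup>+x. ennreal (norm (f (Complex x y)) powr p) \<partial>lborel) \<le> ennreal (hardy_norm p f powr p)"
proof -
  define I where "I = (LINT x|lborel. norm (f (Complex x y)) powr p)"
  have I: "I \<ge> 0" unfolding I_def by (rule Bochner_Integration.integral_nonneg) simp
  have "hardy_mean p f y \<le> hardy_norm p f"
    unfolding hardy_norm_def using f y by (intro cSUP_upper) (auto simp: hardy_space_def)
  then have "(I powr (1 / p)) powr p \<le> hardy_norm p f powr p"
    unfolding hardy_mean_def I_def[symmetric] using p by (intro powr_mono2) auto
  then have "I \<le> hardy_norm p f powr p" using p I by (simp add: powr_powr)
  moreover have "(\<integral>\<^sup>+x. ennreal (norm (f (Complex x y)) powr p) \<partial>lborel) = ennreal I"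
    unfolding I_def using f y by (intro nn_integral_eq_integral) (auto simp: hardy_space_def)
  ultimately show ?thesis by (simp add: ennreal_leI)
qed

lemma hardy_spaceI:
  assumes hol: "f holomorphic_on upper_half_plane" and p: "0 < p" and M: "0 \<le> M"
    and le: "\<And>y. 0 < y \<Longrightarrow> (\<integral>\<^sup>+x. ennreal (norm (f (Complex x y)) powr p) \<partial>lborel) \<le> ennreal M"
  shows "f \<in> hardy_space p" "hardy_norm p f \<le> M powr (1 / p)"
proof -
  have int: "integrable lborel (\<lambda>x. norm (f (Complex x y)) powr p)" if y: "0 < y" for y
  proof (rule integrableI_bounded)
    show "(\<lambda>x. norm (f (Complex x y)) powr p) \<in> borel_measurable lborel"
      using borel_measurable_continuous_onI[OF hardy_line_continuous[OF hol y p]] by simp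
    show "(\<integral>\<^sup>+x. ennreal (norm (norm (f (Complex x y)) powr p)) \<partial>lborel) < \<infinity>"
      using le[OF y] by (simp add: le_less_trans)
  qed
  have mean: "hardy_mean p f y \<le> M powr (1 / p)" if y: "0 < y" for y
  proof -
    have "ennreal (LINT x|lborel. norm (f (Complex x y)) powr p) \<le> ennreal M"
      using le[OF y] nn_integral_eq_integral[OF int[OF y]] by simp
    then have "(LINT x|lborel. norm (f (Complex x y)) powr p) \<le> M" using M by simp
    moreover have "(LINT x|lborel. norm (f (Complex x y)) powr p) \<ge> 0"
      by (rule Bochner_Integration.integral_nonneg) simp
    ultimately show ?thesis unfolding hardy_mean_def using p by (intro powr_mono2) auto
  qed
  show "f \<in> hardy_space p"
    unfolding hardy_space_def using hol int mean by (auto intro!: bdd_aboveI2)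
  show "hardy_norm p f \<le> M powr (1 / p)"
    unfolding hardy_norm_def using mean by (intro cSUP_least) auto
qed

lemma hardy_norm_nonneg: 
  assumes "f \<in> hardy_space p" shows "0 \<le> hardy_norm p f"
proof -
  have "hardy_mean p f 1 \<le> hardy_norm p f"
    unfolding hardy_norm_def using assms by (intro cSUP_upper) (auto simp: hardy_space_def)
  then show ?thesis unfolding hardy_mean_def by (rule order_trans[rotated]) simp
qed

lemma nn_integral_unit_interval:
  fixes h :: "real \<Rightarrow> real"
  assumes "continuous_on UNIV h" "\<And>x. 0 \<le> h x"
  shows "ennreal (integral {0..1} h) = (\<integral>\<^sup>+\<tau>. indicator {0..1} \<tau> * ennreal (h \<tau>) \<partial>lborel)"
proof -
  have "(h has_integral integral {0..1} h) {0..1}"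
    by (intro integrable_integral integrable_continuous_real continuous_on_subset[OF assms(1)]) auto
  from nn_integral_has_integral_lebesgue'[OF assms(2) this]
  show ?thesis by (simp add: mult.commute)
qed

text \<open>
  The point \<open>z\<close> lies in every disc of radius \<open>\<rho> = Im z / 2\<close> whose centre is shifted horizontally from \<open>z\<close> by
  at most \<open>\<rho> / 2\<close>. Averaging the circle means over these shifts turns them, by Fubini, into
  averages of integrals along horizontal lines, which are bounded by \<open>M\<close>. No area
  integrals or polar coordinates enter.
\<close>
lemma hardy_growth:
  assumes hol: "f holomorphic_on upper_half_plane" and p: "0 < p" and M: "0 \<le> M"
    and le: "\<And>y. 0 < y \<Longrightarrow> (\<integral>\<^sup>+x. ennreal (norm (f (Complex x y)) powr p) \<partial>lborel) \<le> ennreal M"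
    and z: "Im z > 0"
  shows "norm (f z) powr p \<le> 4 * M / Im z"
proof -
  define \<rho> where "\<rho> = Im z / 2"
  have \<rho>: "\<rho> > 0" using z by (simp add: \<rho>_def)
  define h where "h = (\<lambda>s \<tau>. norm (f (z + of_real s + of_real \<rho> * circlepath 0 1 \<tau>)) powr p)"
  define c where "c = norm (f z) powr p"
  have circ: "norm (circlepath 0 1 \<tau>) = 1" for \<tau> by (simp add: circlepath)
  have Im_pos: "Im (z + of_real s + of_real \<rho> * \<zeta>) > 0" if "norm \<zeta> < 2" for s \<zeta>
  proof -
    have "\<bar>Im \<zeta>\<bar> < 2" using abs_Im_le_cmod[of \<zeta>] that by linarith
    then have "\<rho> * (-2) < \<rho> * Im \<zeta>" using \<rho> by (intro mult_strict_left_mono) auto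
    then show ?thesis by (simp add: \<rho>_def)
  qed
  have conth: "continuous_on UNIV (\<lambda>x. h (fst x) (snd x))"
    unfolding h_def
  proof (intro continuous_on_powr' continuous_intros)
    show "continuous_on UNIV (\<lambda>x. f (z + of_real (fst x) + of_real \<rho> * circlepath 0 1 (snd x)))"
      by (rule continuous_on_compose2[OF holomorphic_on_imp_continuous_on[OF hol]])
         (use Im_pos circ in \<open>auto simp: circlepath upper_half_plane_def intro!: continuous_intros\<close>)
  qed (use p in auto)
  have conth2: "continuous_on UNIV (\<lambda>\<tau>. h s \<tau>)" for s
    by (rule continuous_on_compose2[OF conth, of UNIV "\<lambda>\<tau>. (s, \<tau>)", simplified]) (auto intro!: continuous_intros)
  have [measurable]: "(\<lambda>(s, \<tau>). h s \<tau>) \<in> borel_measurable (borel \<Otimes>\<^sub>M borel)"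
    using borel_measurable_continuous_onI[OF conth] by (simp add: borel_prod case_prod_unfold)
  have point: "ennreal c \<le> 2 * (\<integral>\<^sup>+\<tau>. indicator {0..1} \<tau> * ennreal (h s \<tau>) \<partial>lborel)" if s: "\<bar>s\<bar> \<le> \<rho> / 2" for s
  proof -
    define g where "g = (\<lambda>\<zeta>. f (z + of_real s + of_real \<rho> * \<zeta>))"
    have g: "g holomorphic_on ball 0 2"
      unfolding g_def
      by (rule holomorphic_on_compose_gen[OF _ hol, unfolded o_def])
         (use Im_pos in \<open>auto simp: upper_half_plane_def intro!: holomorphic_intros\<close>)
    define a where "a = complex_of_real (- s / \<rho>)"
    have a: "norm a \<le> 1/2" using s \<rho> by (simp add: a_def norm_divide field_simps)
    have ga: "g a = f z" using \<rho> by (simp add: g_def a_def)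
    have I0: "integral {0..1} (h s) \<ge> 0" 
      by (rule integral_nonneg[OF integrable_continuous_real[OF continuous_on_subset[OF conth2 subset_UNIV]]]) (simp add: h_def)
    have "c \<le> integral {0..1} (h s) / (1 - norm a)"
      using powr_le_circle_mean[OF g _ _ p, of a] a unfolding c_def ga by (simp add: g_def h_def)
    also have "\<dots> \<le> integral {0..1} (h s) / (1/2)" using a I0 by (intro divide_left_mono) auto
    finally have "c \<le> 2 * integral {0..1} (h s)" by simp
    then have "ennreal c \<le> ennreal (2 * integral {0..1} (h s))" by (rule ennreal_leI)
    also have "\<dots> = 2 * (\<integral>\<^sup>+\<tau>. indicator {0..1} \<tau> * ennreal (h s \<tau>) \<partial>lborel)"
      using nn_integral_unit_interval[OF conth2, of s] by (simp add: ennreal_mult' h_def)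
    finally show ?thesis .
  qed
  have line: "(\<integral>\<^sup>+s. ennreal (h s \<tau>) \<partial>lborel) \<le> ennreal M" for \<tau>
  proof -
    define x0 y0 where "x0 = Re (z + of_real \<rho> * circlepath 0 1 \<tau>)" and "y0 = Im (z + of_real \<rho> * circlepath 0 1 \<tau>)"
    have y0: "y0 > 0" unfolding y0_def using Im_pos[of "circlepath 0 1 \<tau>" 0] circ by simp
    have "(\<integral>\<^sup>+x. ennreal (norm (f (Complex x y0)) powr p) \<partial>lborel) = 
       ennreal \<bar>1\<bar> * (\<integral>\<^sup>+s. ennreal (norm (f (Complex (x0 + 1 * s) y0)) powr p) \<partial>lborel)"
    proof (rule nn_integral_real_affine)
      show "(\<lambda>x. ennreal (norm (f (Complex x y0)) powr p)) \<in> borel_measurable borel"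
        using borel_measurable_continuous_onI[OF hardy_line_continuous[OF hol y0 p]] by simp
    qed simp
    also have "(\<lambda>s. ennreal (norm (f (Complex (x0 + 1 * s) y0)) powr p)) = (\<lambda>s. ennreal (h s \<tau>))"
    proof
      fix s
      have "Complex (x0 + 1 * s) y0 = z + of_real s + of_real \<rho> * circlepath 0 1 \<tau>"
        by (simp add: complex_eq_iff x0_def y0_def)
      then show "ennreal (norm (f (Complex (x0 + 1 * s) y0)) powr p) = ennreal (h s \<tau>)"
        unfolding h_def by (simp only:)
    qed
    finally show ?thesis using le[OF y0] by simp
  qed
  have "ennreal (c * \<rho>) = (\<integral>\<^sup>+s. ennreal c * indicator {-\<rho>/2..\<rho>/2} s \<partial>lborel)"
    using \<rho> by (simp add: nn_integral_cmult_indicator ennreal_mult c_def)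
  also have "\<dots> \<le> (\<integral>\<^sup>+s. 2 * (\<integral>\<^sup>+\<tau>. indicator {0..1} \<tau> * ennreal (h s \<tau>) \<partial>lborel) \<partial>lborel)"
  proof (intro nn_integral_mono)
    fix s
    show "ennreal c * indicator {-\<rho>/2..\<rho>/2} s \<le> 2 * (\<integral>\<^sup>+\<tau>. indicator {0..1} \<tau> * ennreal (h s \<tau>) \<partial>lborel)"
    proof (cases "\<bar>s\<bar> \<le> \<rho> / 2")
      case True
      then show ?thesis using point[OF True] by (simp add: indicator_def split: if_splits)
    next
      case False
      then have "indicator {-\<rho>/2..\<rho>/2} s = (0::ennreal)" by (auto simp: indicator_def)
      then show ?thesis by simp
    qed
  qed
  also have "\<dots> = 2 * (\<integral>\<^sup>+s. (\<integral>\<^sup>+\<tau>. indicator {0..1} \<tau> * ennreal (h s \<tau>) \<partial>lborel) \<partial>lborel)"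
    by (rule nn_integral_cmult) measurable
  also have "(\<integral>\<^sup>+s. (\<integral>\<^sup>+\<tau>. indicator {0..1} \<tau> * ennreal (h s \<tau>) \<partial>lborel) \<partial>lborel) = 
      (\<integral>\<^sup>+\<tau>. (\<integral>\<^sup>+s. indicator {0..1} \<tau> * ennreal (h s \<tau>) \<partial>lborel) \<partial>lborel)"
    by (rule lborel_pair.Fubini'[symmetric]) measurable
  also have "\<dots> = (\<integral>\<^sup>+\<tau>. indicator {0..1} \<tau> * (\<integral>\<^sup>+s. ennreal (h s \<tau>) \<partial>lborel) \<partial>lborel)"
    by (intro nn_integral_cong nn_integral_cmult) measurable
  also have "\<dots> \<le> (\<integral>\<^sup>+(\<tau>::real). ennreal M * indicator {0..1} \<tau> \<partial>lborel)"
    using line by (intro nn_integral_mono) (simp add: indicator_def)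
  also have "\<dots> = ennreal M" by (simp add: nn_integral_cmult_indicator)
  finally have "ennreal (c * \<rho>) \<le> ennreal (2 * M)" using M by (simp add: mult_left_mono ennreal_mult')
  then have "c * \<rho> \<le> 2 * M" using M by simp
  then show ?thesis using z by (simp add: c_def \<rho>_def field_simps)
qed

text \<open>
  This is \<open>pi\<close> times the Poisson kernel of the half-plane.
\<close>
definition halfplane_kernel :: "complex \<Rightarrow> real \<Rightarrow> real" where
  "halfplane_kernel v t = Im v / norm (v - of_real t)^2"

lemma halfplane_kernel_nonneg: "Im v > 0 \<Longrightarrow> halfplane_kernel v t \<ge> 0"
  by (simp add: halfplane_kernel_def)

lemma halfplane_kernel_measurable [measurable]: "halfplane_kernel v \<in> borel_measurable borel"
  unfolding halfplane_kernel_def by measurable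

lemma halfplane_kernel_eq: "halfplane_kernel v t = Im (- 1 / (v - of_real t))"
  by (simp add: halfplane_kernel_def Im_divide cmod_power2)

lemma holomorphic_on_scaled_cayley:
  assumes hol: "F holomorphic_on upper_half_plane" and "0 < r" "r < 1" "0 < b" "0 \<le> Y"
  shows "(\<lambda>\<zeta>. F (Complex X b + of_real Y * cayley (of_real r * \<zeta>))) holomorphic_on ball 0 (1 / r)"
    "cball 0 1 \<subseteq> ball (0::complex) (1 / r)" "1 < 1 / r"
proof -
  have sc: "norm (of_real r * \<zeta>) < 1" if "\<zeta> \<in> ball 0 (1 / r)" for \<zeta> :: complex
    using that assms unfolding mem_ball_0 by (simp add: norm_mult field_simps)
  have c: "(\<lambda>\<zeta>. cayley (of_real r * \<zeta>)) holomorphic_on ball 0 (1 / r)"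
    by (rule holomorphic_on_compose_gen[OF _ cayley_holomorphic, unfolded o_def])
       (use sc in \<open>auto intro!: holomorphic_intros simp: mem_ball_0 simp del: mem_ball\<close>)
  show "(\<lambda>\<zeta>. F (Complex X b + of_real Y * cayley (of_real r * \<zeta>))) holomorphic_on ball 0 (1 / r)"
  proof (rule holomorphic_on_compose_gen[OF _ hol, unfolded o_def])
    show "(\<lambda>\<zeta>. Complex X b + of_real Y * cayley (of_real r * \<zeta>)) holomorphic_on ball 0 (1 / r)"
      by (intro holomorphic_intros c)
    show "(\<lambda>\<zeta>. Complex X b + of_real Y * cayley (of_real r * \<zeta>)) ` ball 0 (1 / r) \<subseteq> upper_half_plane"
    proof (intro image_subsetI upper_half_planeI)
      fix \<zeta> :: complex assume "\<zeta> \<in> ball 0 (1 / r)"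
      from Im_cayley_pos[OF sc[OF this]] show "Im (Complex X b + of_real Y * cayley (of_real r * \<zeta>)) > 0"
        using assms by (simp add: add_pos_nonneg)
    qed
  qed
  show r1: "1 < 1 / r" using assms by simp
  show "cball 0 1 \<subseteq> ball (0::complex) (1 / r)" using r1 by (intro cball_subset_ball_iff[THEN iffD2]) simp
qed

lemma continuous_on_shifted_half_plane:
  assumes hol: "F holomorphic_on upper_half_plane" and "0 < b" "0 \<le> Y"
  shows "continuous_on {z. Im z \<ge> 0} (\<lambda>\<zeta>. F (Complex X b + of_real Y * \<zeta>))"
  by (rule continuous_on_compose2[OF holomorphic_on_imp_continuous_on[OF hol]])
     (use assms in \<open>auto intro!: continuous_intros simp: upper_half_plane_def add_pos_nonneg\<close>)

text \<open>
  Growth makes \<open>norm (f z) powr p\<close> bounded above the line at height \<open>\<epsilon>\<close>, so there it is dominated by the Poisson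
  integral of its values on that line.
\<close>
lemma hardy_poisson:
  assumes hol: "f holomorphic_on upper_half_plane" and p: "0 < p" and M: "0 \<le> M"
    and le: "\<And>y. 0 < y \<Longrightarrow> (\<integral>\<^sup>+x. ennreal (norm (f (Complex x y)) powr p) \<partial>lborel) \<le> ennreal M"
    and \<epsilon>: "0 < \<epsilon>" and v: "Im v > 0"
  shows "ennreal (norm (f (v + \<i> * of_real \<epsilon>)) powr p) \<le>
    (\<integral>\<^sup>+t. ennreal (halfplane_kernel v t / pi * norm (f (Complex t \<epsilon>)) powr p) \<partial>lborel)"
proof -
  define X Y where "X = Re v" and "Y = Im v"
  have Y: "Y > 0" using v by (simp add: Y_def)
  have fm [measurable]: "(\<lambda>t. norm (f (Complex t \<epsilon>)) powr p) \<in> borel_measurable borel"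
    using borel_measurable_continuous_onI[OF hardy_line_continuous[OF hol \<epsilon> p]] .
  have [measurable]: "(\<lambda>t. norm (f (Complex (X + Y * t) \<epsilon>)) powr p) \<in> borel_measurable borel"
    by (rule measurable_compose[OF _ fm, of "\<lambda>t. X + Y * t"]) measurable
  define u where "u = (\<lambda>\<zeta>. norm (f (Complex X \<epsilon> + of_real Y * \<zeta>)) powr p)"
  have cu: "continuous_on {z. Im z \<ge> 0} u" unfolding u_def
    using continuous_on_shifted_half_plane[OF hol \<epsilon>, of Y X] Y p
    by (intro continuous_on_powr' continuous_intros) auto
  have bu: "\<bar>u \<zeta>\<bar> \<le> 4 * M / \<epsilon>" if "Im \<zeta> \<ge> 0" for \<zeta>
  proof -
    have i: "Im (Complex X \<epsilon> + of_real Y * \<zeta>) \<ge> \<epsilon>" using that Y by simp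
    have "u \<zeta> \<le> 4 * M / Im (Complex X \<epsilon> + of_real Y * \<zeta>)"
      unfolding u_def by (rule hardy_growth[OF hol p M le]) (use i \<epsilon> in auto)
    also have "\<dots> \<le> 4 * M / \<epsilon>" using i \<epsilon> M by (intro divide_left_mono) auto
    finally show ?thesis by (simp add: u_def)
  qed
  have su: "u \<i> \<le> integral {0..1} (\<lambda>\<tau>. u (cayley (of_real r * circlepath 0 1 \<tau>)))" if r: "0 < r" "r < 1" for r
    using powr_le_circle_mean[OF holomorphic_on_scaled_cayley(1)[OF hol r \<epsilon> less_imp_le[OF Y]]
      holomorphic_on_scaled_cayley(3)[OF hol r \<epsilon> less_imp_le[OF Y]] _ p, of 0 X]
    by (simp add: u_def)
  note P = half_plane_poisson_submean[OF cu bu su]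
  have u0: "u \<zeta> \<ge> 0" for \<zeta> by (simp add: u_def)
  have "ennreal (pi * u \<i>) \<le> ennreal (LINT t|lborel. u (of_real t) / (1 + t\<^sup>2))"
    using P(2) by (rule ennreal_leI)
  also have "\<dots> = (\<integral>\<^sup>+t. ennreal (u (of_real t) / (1 + t\<^sup>2)) \<partial>lborel)"
    using P(1) u0 by (intro nn_integral_eq_integral[symmetric]) (auto intro!: AE_I2 divide_nonneg_nonneg)
  also have "\<dots> = (\<integral>\<^sup>+t. ennreal (Y * (halfplane_kernel v (X + Y * t) * norm (f (Complex (X + Y * t) \<epsilon>)) powr p)) \<partial>lborel)"
  proof (intro nn_integral_cong)
    fix t :: real
    have "norm (v - of_real (X + Y * t))^2 = Y^2 * (1 + t^2)"
      unfolding cmod_power2 X_def Y_def by (simp add: power_mult_distrib algebra_simps)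
    then have k: "halfplane_kernel v (X + Y * t) = 1 / (Y * (1 + t^2))"
      using Y by (simp add: halfplane_kernel_def Y_def[symmetric] power2_eq_square)
    have "Complex (X + Y * t) \<epsilon> = Complex X \<epsilon> + of_real Y * of_real t" by (simp add: complex_eq_iff)
    then have "norm (f (Complex (X + Y * t) \<epsilon>)) powr p = u (of_real t)" by (simp only: u_def)
    then show "ennreal (u (of_real t) / (1 + t\<^sup>2)) = ennreal (Y * (halfplane_kernel v (X + Y * t) * norm (f (Complex (X + Y * t) \<epsilon>)) powr p))"
      using Y by (simp add: k)
  qed
  also have "\<dots> = ennreal \<bar>Y\<bar> * (\<integral>\<^sup>+t. ennreal (halfplane_kernel v (X + Y * t) * norm (f (Complex (X + Y * t) \<epsilon>)) powr p) \<partial>lborel)"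
    using Y by (simp add: ennreal_mult' nn_integral_cmult)
  also have "\<dots> = (\<integral>\<^sup>+t. ennreal (halfplane_kernel v t * norm (f (Complex t \<epsilon>)) powr p) \<partial>lborel)"
    using Y by (intro nn_integral_real_affine[symmetric]) auto
  finally have main: "ennreal (pi * u \<i>) \<le> (\<integral>\<^sup>+t. ennreal (halfplane_kernel v t * norm (f (Complex t \<epsilon>)) powr p) \<partial>lborel)" .
  have "u \<i> = norm (f (v + \<i> * of_real \<epsilon>)) powr p"
  proof -
    have "Complex X \<epsilon> + of_real Y * \<i> = v + \<i> * of_real \<epsilon>" by (simp add: complex_eq_iff X_def Y_def)
    then show ?thesis by (simp only: u_def)
  qed
  then have "ennreal (norm (f (v + \<i> * of_real \<epsilon>)) powr p) = ennreal (1 / pi) * ennreal (pi * u \<i>)"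
    using u0[of \<i>] by (simp flip: ennreal_mult)
  also have "\<dots> \<le> ennreal (1 / pi) * (\<integral>\<^sup>+t. ennreal (halfplane_kernel v t * norm (f (Complex t \<epsilon>)) powr p) \<partial>lborel)"
    by (intro mult_left_mono main) simp
  also have "\<dots> = (\<integral>\<^sup>+t. ennreal (1 / pi) * ennreal (halfplane_kernel v t * norm (f (Complex t \<epsilon>)) powr p) \<partial>lborel)"
    by (intro nn_integral_cmult[symmetric]) measurable
  also have "\<dots> = (\<integral>\<^sup>+t. ennreal (halfplane_kernel v t / pi * norm (f (Complex t \<epsilon>)) powr p) \<partial>lborel)"
    using halfplane_kernel_nonneg[OF v] by (intro nn_integral_cong) (simp flip: ennreal_mult)
  finally show ?thesis .
qed

text \<open>
  The integrand is the boundary value of the imaginary part of a holomorphic map \<open>G\<close> with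
  \<open>norm (G z) \<le> 1 / (c * Im z)\<close>. The Poisson formula at \<open>\<i> * y\<close> weights the line by \<open>y / (y^2 + x^2)\<close>; after multiplication by
  \<open>y\<close> the weight increases to 1 as \<open>y\<close> grows, while the value at \<open>\<i> * y\<close> times \<open>pi * y\<close> never exceeds \<open>pi / c\<close>. Fatou's lemma
  gives the sharp constant.
\<close>
lemma kernel_mass_pulled_back:
  assumes hol: "\<phi> holomorphic_on upper_half_plane" and c: "c > 0"
    and ge: "\<And>z. Im z > 0 \<Longrightarrow> Im (\<phi> z) \<ge> c * Im z"
    and \<eta>: "\<eta> > 0" and \<epsilon>: "\<epsilon> < c * \<eta>" "\<epsilon> > 0"
  shows "(\<integral>\<^sup>+x. ennreal (halfplane_kernel (\<phi> (Complex x \<eta>) - \<i> * of_real \<epsilon>) t) \<partial>lborel) \<le> ennreal (pi / c)"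
proof -
  \<comment> \<open>the shift by \<open>\<epsilon> / c\<close> makes \<open>G\<close> decay like \<open>1 / (c * Im z)\<close> in the whole half-plane\<close>
  define G where "G = (\<lambda>z. - 1 / (\<phi> (z + \<i> * of_real (\<epsilon> / c)) - \<i> * of_real \<epsilon> - of_real t))"
  have ec: "\<epsilon> / c > 0" using \<epsilon> c by simp
  define b where "b = \<eta> - \<epsilon> / c"
  have b: "b > 0" using \<epsilon> c by (simp add: b_def field_simps)
  have imd: "Im (\<phi> (z + \<i> * of_real (\<epsilon> / c)) - \<i> * of_real \<epsilon> - of_real t) \<ge> c * Im z" if "Im z > 0" for z
  proof -
    have "Im (\<phi> (z + \<i> * of_real (\<epsilon> / c))) \<ge> c * Im (z + \<i> * of_real (\<epsilon> / c))"
      by (rule ge) (use that ec in simp)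
    also have "c * Im (z + \<i> * of_real (\<epsilon> / c)) = c * Im z + \<epsilon>" using c by (simp add: algebra_simps)
    finally show ?thesis by simp
  qed
  have Ghol: "G holomorphic_on upper_half_plane"
  proof -
    have "(\<lambda>z. \<phi> (z + \<i> * of_real (\<epsilon> / c))) holomorphic_on upper_half_plane"
      by (rule holomorphic_on_compose_gen[OF _ hol, unfolded o_def])
        (use ec in \<open>auto simp: upper_half_plane_def intro!: holomorphic_intros add_pos_pos\<close>)
    moreover have "\<phi> (z + \<i> * of_real (\<epsilon> / c)) - \<i> * of_real \<epsilon> - of_real t \<noteq> 0" if "z \<in> upper_half_plane" for z
    proof
      assume *: "\<phi> (z + \<i> * of_real (\<epsilon> / c)) - \<i> * of_real \<epsilon> - of_real t = 0"
      have "Im z > 0" using that by (simp add: upper_half_plane_def)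
      from imd[OF this] this c show False unfolding * by (simp add: mult_le_0_iff)
    qed
    ultimately show ?thesis unfolding G_def by (intro holomorphic_intros) auto
  qed
  have Gn: "norm (G z) \<le> 1 / (c * Im z)" if "Im z > 0" for z
  proof -
    define d where "d = \<phi> (z + \<i> * of_real (\<epsilon> / c)) - \<i> * of_real \<epsilon> - of_real t"
    have "c * Im z \<le> norm d" using imd[OF that] abs_Im_le_cmod[of d] unfolding d_def by linarith
    moreover have "c * Im z > 0" using that c by simp
    moreover have "norm (G z) = 1 / norm d" by (simp add: G_def d_def norm_divide)
    ultimately show ?thesis by (simp add: frac_le)
  qed
  have Gk: "Im (G (Complex x b)) = halfplane_kernel (\<phi> (Complex x \<eta>) - \<i> * of_real \<epsilon>) t" for x
  proof -
    have "Complex x b + \<i> * of_real (\<epsilon> / c) = Complex x \<eta>" by (simp add: complex_eq_iff b_def)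
    then show ?thesis unfolding halfplane_kernel_eq G_def by (simp only:)
  qed
  have Gpos: "Im (G (Complex x b)) \<ge> 0" for x
    unfolding Gk 
  proof (rule halfplane_kernel_nonneg)
    have "c * \<eta> \<le> Im (\<phi> (Complex x \<eta>))" using ge[of "Complex x \<eta>"] \<eta> by simp
    then show "Im (\<phi> (Complex x \<eta>) - \<i> * of_real \<epsilon>) > 0" using \<epsilon> by simp
  qed
  have cG: "continuous_on UNIV (\<lambda>x. Im (G (Complex x b)))"
  proof -
    have "continuous_on UNIV (\<lambda>x. G (Complex 0 b + of_real 1 * of_real x))"
      by (rule continuous_on_compose2[OF continuous_on_shifted_half_plane[OF Ghol b]]) (auto intro!: continuous_intros)
    moreover have "Complex 0 b + of_real 1 * of_real x = Complex x b" for x by (simp add: complex_eq_iff)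
    ultimately show ?thesis by (intro continuous_intros) (simp only:)
  qed
  have [measurable]: "(\<lambda>x. Im (G (Complex x b))) \<in> borel_measurable borel"
    using borel_measurable_continuous_onI[OF cG] .
  have step: "(\<integral>\<^sup>+x. ennreal (Im (G (Complex x b)) / (1 + (x / y)^2)) \<partial>lborel) \<le> ennreal (pi / c)" if y: "y > 0" for y
  proof -
    define u where "u = (\<lambda>\<zeta>. - Im (G (Complex 0 b + of_real y * \<zeta>)))"
    have y0: "0 \<le> y" using y by simp
    have cu: "continuous_on {z. Im z \<ge> 0} u"
      unfolding u_def by (intro continuous_intros continuous_on_shifted_half_plane[OF Ghol b y0])
    have bu: "\<bar>u \<zeta>\<bar> \<le> 1 / (c * b)" if "Im \<zeta> \<ge> 0" for \<zeta>
    proof -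
      have i: "Im (Complex 0 b + of_real y * \<zeta>) \<ge> b" using that y by simp
      have "\<bar>u \<zeta>\<bar> \<le> norm (G (Complex 0 b + of_real y * \<zeta>))" unfolding u_def using abs_Im_le_cmod by simp
      also have "\<dots> \<le> 1 / (c * Im (Complex 0 b + of_real y * \<zeta>))" by (rule Gn) (use i b in linarith)
      also have "\<dots> \<le> 1 / (c * b)" using i b c by (intro divide_left_mono mult_left_mono mult_pos_pos) auto
      finally show ?thesis .
    qed
    have su: "u \<i> \<le> integral {0..1} (\<lambda>\<tau>. u (cayley (of_real r * circlepath 0 1 \<tau>)))" if r: "0 < r" "r < 1" for r
    proof -
      note H = holomorphic_on_scaled_cayley[OF Ghol r b y0]
      have "((\<lambda>\<tau>. - Im (G (Complex 0 b + of_real y * cayley (of_real r * circlepath 0 1 \<tau>)))) 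
          has_integral - Im (G (Complex 0 b + of_real y * cayley (of_real r * 0)))) {0..1}"
        by (intro has_integral_neg has_integral_Im mean_value_circle[OF H(1,2)]) auto
      from integral_unique[OF this] show ?thesis by (simp add: u_def)
    qed
    note P = half_plane_poisson_submean[OF cu bu su]
    have ui: "- u \<i> \<le> 1 / (c * y)"
    proof -
      have "- u \<i> \<le> norm (G (Complex 0 b + of_real y * \<i>))" unfolding u_def using abs_Im_le_cmod[of "G (Complex 0 b + of_real y * \<i>)"] by simp
      also have "\<dots> \<le> 1 / (c * Im (Complex 0 b + of_real y * \<i>))" by (rule Gn) (use b y in simp)
      also have "\<dots> \<le> 1 / (c * y)" using b c y by (intro divide_left_mono mult_left_mono mult_pos_pos) auto
      finally show ?thesis .
    qed
    have line: "- u (of_real s) = Im (G (Complex (y * s) b))" for s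
    proof -
      have "Complex 0 b + of_real y * of_real s = Complex (y * s) b" by (simp add: complex_eq_iff)
      then show ?thesis unfolding u_def by (simp only: minus_minus)
    qed
    have "(\<integral>\<^sup>+x. ennreal (Im (G (Complex x b)) / (1 + (x / y)^2)) \<partial>lborel) = 
      ennreal \<bar>y\<bar> * (\<integral>\<^sup>+s. ennreal (Im (G (Complex (0 + y * s) b)) / (1 + ((0 + y * s) / y)^2)) \<partial>lborel)"
    proof (rule nn_integral_real_affine)
      show "(\<lambda>x. ennreal (Im (G (Complex x b)) / (1 + (x / y)\<^sup>2))) \<in> borel_measurable borel" by measurable
    qed (use y in simp)
    also have "\<dots> = ennreal y * (\<integral>\<^sup>+s. ennreal (- (u (of_real s) / (1 + s^2))) \<partial>lborel)"
    proof -
      have "- (u (of_real s) / (1 + s^2)) = Im (G (Complex (y * s) b)) / (1 + s^2)" for s by (simp flip: line)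
      then show ?thesis using y by simp
    qed
    also have "(\<integral>\<^sup>+s. ennreal (- (u (of_real s) / (1 + s^2))) \<partial>lborel) = ennreal (LINT s|lborel. - (u (of_real s) / (1 + s^2)))"
    proof (rule nn_integral_eq_integral)
      show "integrable lborel (\<lambda>s. - (u (of_real s) / (1 + s\<^sup>2)))" using P(1) by (rule integrable_minus)
      show "AE s in lborel. 0 \<le> - (u (of_real s) / (1 + s\<^sup>2))"
        using Gpos by (intro AE_I2) (simp add: minus_divide_left line)
    qed
    also have "\<dots> \<le> ennreal (pi * (1 / (c * y)))"
    proof (rule ennreal_leI)
      have "(LINT s|lborel. - (u (of_real s) / (1 + s^2))) \<le> pi * (- u \<i>)" using P(2) by simp
      also have "\<dots> \<le> pi * (1 / (c * y))" using ui by (intro mult_left_mono) auto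
      finally show "(LINT s|lborel. - (u (of_real s) / (1 + s^2))) \<le> pi * (1 / (c * y))" .
    qed
    finally have "(\<integral>\<^sup>+x. ennreal (Im (G (Complex x b)) / (1 + (x / y)^2)) \<partial>lborel) \<le> ennreal y * ennreal (pi * (1 / (c * y)))"
      by (simp add: mult_left_mono)
    also have "\<dots> = ennreal (pi / c)" using y c by (simp flip: ennreal_mult)
    finally show ?thesis .
  qed
  have "(\<integral>\<^sup>+x. ennreal (Im (G (Complex x b))) \<partial>lborel) =
    (\<integral>\<^sup>+x. liminf (\<lambda>n. ennreal (Im (G (Complex x b)) / (1 + (x / real (Suc n))^2))) \<partial>lborel)"
  proof (rule nn_integral_cong)
    fix x
    have "(\<lambda>n. x / real (Suc n)) \<longlonglongrightarrow> 0" by real_asymp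
    then have "(\<lambda>n. ennreal (Im (G (Complex x b)) / (1 + (x / real (Suc n))^2))) \<longlonglongrightarrow> ennreal (Im (G (Complex x b)) / (1 + 0^2))"
      by (intro tendsto_intros tendsto_ennrealI) auto
    then show "ennreal (Im (G (Complex x b))) = liminf (\<lambda>n. ennreal (Im (G (Complex x b)) / (1 + (x / real (Suc n))^2)))"
      by (simp add: lim_imp_Liminf)
  qed
  also have "\<dots> \<le> liminf (\<lambda>n. \<integral>\<^sup>+x. ennreal (Im (G (Complex x b)) / (1 + (x / real (Suc n))^2)) \<partial>lborel)"
    by (rule nn_integral_liminf) measurable
  also have "\<dots> \<le> ennreal (pi / c)"
    by (intro Liminf_le) (auto intro!: always_eventually step)
  finally show ?thesis unfolding Gk .
qed

section \<open>Norms of composition operators\<close>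

text \<open>
  Poisson domination on a line at height \<open>\<epsilon>\<close> below all values of \<open>\<phi>\<close> on the line at height \<open>\<eta>\<close>, followed by
  integration over the latter, moves the whole estimate to the kernel, where Fubini applies.
\<close>
lemma composition_bounded:
  assumes hol: "\<phi> holomorphic_on upper_half_plane" and c: "c > 0"
    and ge: "\<And>z. Im z > 0 \<Longrightarrow> Im (\<phi> z) \<ge> c * Im z"
    and p: "0 < p"
  shows "hardy_bound p (comp_op \<phi>) ((1 / c) powr (1 / p))"
  unfolding hardy_bound_def
proof (intro ballI)
  fix f assume f: "f \<in> hardy_space p"
  then have fhol: "f holomorphic_on upper_half_plane" by (simp add: hardy_space_def)
  define M where "M = hardy_norm p f powr p"
  have M: "M \<ge> 0" by (simp add: M_def)
  note le = hardy_space_nn_integral_le[OF f _ p, folded M_def]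
  have U: "\<phi> z \<in> upper_half_plane" if "z \<in> upper_half_plane" for z
  proof -
    have z: "Im z > 0" using that by (simp add: upper_half_plane_def)
    then have "c * Im z > 0" using c by simp
    then show ?thesis using ge[OF z] by (simp add: upper_half_plane_def)
  qed
  have chol: "comp_op \<phi> f holomorphic_on upper_half_plane"
    unfolding comp_op_def by (rule holomorphic_on_compose_gen[OF hol fhol]) (use U in auto)
  have main: "(\<integral>\<^sup>+x. ennreal (norm (comp_op \<phi> f (Complex x \<eta>)) powr p) \<partial>lborel) \<le> ennreal (M / c)" if \<eta>: "0 < \<eta>" for \<eta>
  proof -
    define \<epsilon> where "\<epsilon> = c * \<eta> / 2"
    have \<epsilon>: "\<epsilon> < c * \<eta>" "0 < \<epsilon>" using c \<eta> by (auto simp: \<epsilon>_def)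
    define v where "v = (\<lambda>x. \<phi> (Complex x \<eta>) - \<i> * of_real \<epsilon>)"
    have v: "Im (v x) > 0" for x
    proof -
      have "c * \<eta> \<le> Im (\<phi> (Complex x \<eta>))" using ge[of "Complex x \<eta>"] \<eta> by simp
      then show ?thesis using \<epsilon> by (simp add: v_def)
    qed
    define h where "h = (\<lambda>t. norm (f (Complex t \<epsilon>)) powr p)"
    have ch: "continuous_on UNIV h" unfolding h_def by (rule hardy_line_continuous[OF fhol \<epsilon>(2) p])
    have cv: "continuous_on UNIV v" unfolding v_def
      by (intro continuous_intros continuous_on_compose2[OF holomorphic_on_imp_continuous_on[OF hol]])
         (use \<eta> in \<open>auto simp: Complex_eq upper_half_plane_def intro!: continuous_intros\<close>)
    have nz: "v x - of_real t \<noteq> 0" for x t using v[of x] by (auto simp: complex_eq_iff)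
    have cK: "continuous_on UNIV (\<lambda>z. halfplane_kernel (v (fst z)) (snd z))"
      unfolding halfplane_kernel_def
      by (intro continuous_intros continuous_on_compose2[OF cv]) (use nz in \<open>auto intro!: continuous_intros\<close>)
    have [measurable]: "(\<lambda>(x, t). halfplane_kernel (v x) t) \<in> borel_measurable (borel \<Otimes>\<^sub>M borel)"
      using borel_measurable_continuous_onI[OF cK] by (simp add: borel_prod case_prod_unfold)
    have [measurable]: "h \<in> borel_measurable borel" using borel_measurable_continuous_onI[OF ch] .
    have K0: "halfplane_kernel (v x) t \<ge> 0" for x t by (rule halfplane_kernel_nonneg[OF v])
    have h0: "h t \<ge> 0" for t by (simp add: h_def)
    have "(\<integral>\<^sup>+x. ennreal (norm (comp_op \<phi> f (Complex x \<eta>)) powr p) \<partial>lborel) \<le>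
      (\<integral>\<^sup>+x. (\<integral>\<^sup>+t. ennreal (halfplane_kernel (v x) t / pi * h t) \<partial>lborel) \<partial>lborel)"
    proof (rule nn_integral_mono)
      fix x
      show "ennreal (norm (comp_op \<phi> f (Complex x \<eta>)) powr p) \<le> (\<integral>\<^sup>+t. ennreal (halfplane_kernel (v x) t / pi * h t) \<partial>lborel)"
        using hardy_poisson[OF fhol p M le \<epsilon>(2) v[of x]] by (simp add: v_def h_def comp_op_def)
    qed
    also have "\<dots> = (\<integral>\<^sup>+t. (\<integral>\<^sup>+x. ennreal (halfplane_kernel (v x) t / pi * h t) \<partial>lborel) \<partial>lborel)"
      by (rule lborel_pair.Fubini'[symmetric]) measurable
    also have "\<dots> = (\<integral>\<^sup>+t. ennreal (h t / pi) * (\<integral>\<^sup>+x. ennreal (halfplane_kernel (v x) t) \<partial>lborel) \<partial>lborel)"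
      by (intro nn_integral_cong, subst nn_integral_cmult[symmetric]) 
         (auto simp: K0 h0 mult.commute simp flip: ennreal_mult)
    also have "\<dots> \<le> (\<integral>\<^sup>+t. ennreal (h t / pi) * ennreal (pi / c) \<partial>lborel)"
      unfolding v_def by (intro nn_integral_mono mult_left_mono kernel_mass_pulled_back[OF hol c ge \<eta> \<epsilon>]) auto
    also have "\<dots> = (\<integral>\<^sup>+t. ennreal (1 / c) * ennreal (h t) \<partial>lborel)"
      using c by (intro nn_integral_cong) (simp add: h0 flip: ennreal_mult)
    also have "\<dots> = ennreal (1 / c) * (\<integral>\<^sup>+t. ennreal (h t) \<partial>lborel)" by (rule nn_integral_cmult) measurable
    also have "\<dots> \<le> ennreal (1 / c) * ennreal M" unfolding h_def by (intro mult_left_mono le \<epsilon>) simp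
    also have "\<dots> = ennreal (M / c)" using c M by (simp flip: ennreal_mult)
    finally show ?thesis .
  qed
  have Mc: "0 \<le> M / c" using M c by simp
  have "(M / c) powr (1 / p) = (1 / c) powr (1 / p) * hardy_norm p f"
    using hardy_norm_nonneg[OF f] c p powr_mult[of "1 / c" M "1 / p"] by (simp add: M_def powr_powr)
  then show "comp_op \<phi> f \<in> hardy_space p \<and> hardy_norm p (comp_op \<phi> f) \<le> (1 / c) powr (1 / p) * hardy_norm p f"
    using hardy_spaceI[OF chol p Mc main] by simp
qed

lemma hardy_cong:
  assumes "\<And>z. Im z > 0 \<Longrightarrow> f z = g z"
  shows "f \<in> hardy_space p \<longleftrightarrow> g \<in> hardy_space p" "hardy_norm p f = hardy_norm p g"
proof -
  have h: "hardy_mean p f y = hardy_mean p g y" if "y > 0" for y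
    using assms that by (simp add: hardy_mean_def)
  then have im: "hardy_mean p f ` {0<..} = hardy_mean p g ` {0<..}" by (intro image_cong) auto
  have "f holomorphic_on upper_half_plane \<longleftrightarrow> g holomorphic_on upper_half_plane"
    using assms by (intro holomorphic_cong) (auto simp: upper_half_plane_def)
  then show "f \<in> hardy_space p \<longleftrightarrow> g \<in> hardy_space p"
    unfolding hardy_space_def mem_Collect_eq im using assms by simp
  show "hardy_norm p f = hardy_norm p g" unfolding hardy_norm_def im ..
qed

lemma Cauchy_density_scaled:
  assumes b: "b > 0"
  shows "(\<integral>\<^sup>+x. ennreal (1 / ((x - a)\<^sup>2 + b\<^sup>2)) \<partial>lborel) = ennreal (pi / b)"
proof -
  have "(\<integral>\<^sup>+x. ennreal (1 / ((x - a)\<^sup>2 + b\<^sup>2)) \<partial>lborel) = 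
    ennreal \<bar>b\<bar> * (\<integral>\<^sup>+t. ennreal (1 / ((a + b * t - a)\<^sup>2 + b\<^sup>2)) \<partial>lborel)"
    using b by (intro nn_integral_real_affine) auto
  also have "\<dots> = ennreal b * (\<integral>\<^sup>+t. ennreal (1 / b^2) * ennreal (1 / (1 + t\<^sup>2)) \<partial>lborel)"
  proof -
    have "1 / ((a + b * t - a)\<^sup>2 + b\<^sup>2) = 1 / b^2 * (1 / (1 + t\<^sup>2))" for t
    proof -
      have "(a + b * t - a)\<^sup>2 + b\<^sup>2 = b^2 * (1 + t^2)" by (simp add: power2_eq_square algebra_simps)
      then show ?thesis by simp
    qed
    then have "ennreal (1 / ((a + b * t - a)\<^sup>2 + b\<^sup>2)) = ennreal (1 / b^2) * ennreal (1 / (1 + t\<^sup>2))" for t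
      by (simp only:) (rule ennreal_mult, auto)
    then show ?thesis by (simp only: abs_of_pos[OF b])
  qed
  also have "\<dots> = ennreal b * (ennreal (1 / b^2) * (\<integral>\<^sup>+t. ennreal (1 / (1 + t\<^sup>2)) \<partial>lborel))"
    by (subst nn_integral_cmult) auto
  also have "(\<integral>\<^sup>+t. ennreal (1 / (1 + t\<^sup>2)) \<partial>lborel) = ennreal pi"
    using nn_integral_eq_integral[OF Cauchy_density(1)] Cauchy_density(2) by simp
  also have "ennreal b * (ennreal (1 / b^2) * ennreal pi) = ennreal (pi / b)"
    using b by (simp add: power2_eq_square flip: ennreal_mult)
  finally show ?thesis .
qed

text \<open>
  The function is \<open>(z - cnj w) powr (- 2 / p)\<close>; the \<open>p\<close>-th power of its modulus is, up to a constant, the modulus of the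
  Bergman kernel at \<open>w\<close>, so its size at \<open>w\<close> is comparable to the largest one that its norm permits.
\<close>
lemma hardy_test_function:
  assumes p: "0 < p" and w: "Im w > 0"
  obtains f where "f \<in> hardy_space p" "hardy_norm p f powr p \<le> pi / Im w"
    "\<And>z. Im z > 0 \<Longrightarrow> norm (f z) powr p = 1 / norm (z - cnj w)^2"
proof -
  define f where "f = (\<lambda>z. (z - cnj w) powr of_real (- 2 / p))"
  have nz: "z - cnj w \<noteq> 0" "z - cnj w \<notin> \<real>\<^sub>\<le>\<^sub>0" if "Im z > 0" for z
  proof -
    have "Im (z - cnj w) > 0" using that w by simp
    then show "z - cnj w \<noteq> 0" "z - cnj w \<notin> \<real>\<^sub>\<le>\<^sub>0" by (auto simp: complex_nonpos_Reals_iff)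
  qed
  have hol: "f holomorphic_on upper_half_plane" unfolding f_def
    by (intro holomorphic_intros) (use nz in \<open>auto simp: upper_half_plane_def\<close>)
  have n: "norm (f z) powr p = 1 / norm (z - cnj w)^2" if "Im z > 0" for z
  proof -
    have "norm (f z) = norm (z - cnj w) powr (- 2 / p)"
      unfolding f_def powr_def using nz(1)[OF that] by (simp add: Re_Ln)
    then have "norm (f z) powr p = norm (z - cnj w) powr (- 2)" using p by (simp add: powr_powr)
    then show ?thesis using nz(1)[OF that] by (simp add: powr_minus powr_numeral divide_inverse)
  qed
  have M: "0 \<le> pi / Im w" using w by simp
  have le: "(\<integral>\<^sup>+x. ennreal (norm (f (Complex x y)) powr p) \<partial>lborel) \<le> ennreal (pi / Im w)" if y: "0 < y" for y
  proof -
    have "norm (f (Complex x y)) powr p = 1 / ((x - Re w)^2 + (y + Im w)^2)" for x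
      using n[of "Complex x y"] y by (simp add: cmod_power2)
    then have "(\<integral>\<^sup>+x. ennreal (norm (f (Complex x y)) powr p) \<partial>lborel) = ennreal (pi / (y + Im w))"
      using Cauchy_density_scaled[of "y + Im w" "Re w"] w y by simp
    also have "\<dots> \<le> ennreal (pi / Im w)" using w y by (intro ennreal_leI divide_left_mono) auto
    finally show ?thesis .
  qed
  note H = hardy_spaceI[OF hol p M le]
  have "hardy_norm p f powr p \<le> ((pi / Im w) powr (1 / p)) powr p"
    using H hardy_norm_nonneg p by (intro powr_mono2) auto
  also have "\<dots> = pi / Im w" using w p by (simp add: powr_powr)
  finally show ?thesis using H n that by blast
qed

text \<open>
  The test function for the point \<open>\<phi> z\<close> itself is compared with the growth bound at \<open>z\<close>. The factor \<open>16 * pi\<close> is not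
  sharp; it disappears when the estimate is applied to iterates.
\<close>
lemma composition_bound_imp:
  assumes maps: "\<And>z. Im z > 0 \<Longrightarrow> Im (\<phi> z) > 0" and p: "0 < p" and C: "hardy_bound p (comp_op \<phi>) C"
    and z: "Im z > 0"
  shows "C > 0" "Im z \<le> 16 * pi * C powr p * Im (\<phi> z)"
proof -
  define w where "w = \<phi> z"
  define v where "v = Im w"
  have v: "v > 0" using maps[OF z] by (simp add: v_def w_def)
  obtain f where f: "f \<in> hardy_space p" "hardy_norm p f powr p \<le> pi / v"
    "\<And>z. Im z > 0 \<Longrightarrow> norm (f z) powr p = 1 / norm (z - cnj w)^2"
    using hardy_test_function[OF p, of w] v unfolding v_def by metis
  define g where "g = comp_op \<phi> f"
  have g: "g \<in> hardy_space p" "hardy_norm p g \<le> C * hardy_norm p f"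
    using C f(1) by (auto simp: hardy_bound_def g_def)
  have "norm (g z) powr p \<le> 4 * hardy_norm p g powr p / Im z"
    using g(1) by (intro hardy_growth[OF _ p _ hardy_space_nn_integral_le[OF g(1) _ p] z]) (auto simp: hardy_space_def)
  moreover have "norm (g z) powr p = 1 / (4 * v^2)"
  proof -
    have "w - cnj w = \<i> * of_real (2 * v)" by (simp add: complex_eq_iff v_def)
    then have "norm (w - cnj w)^2 = 4 * v^2" by (simp add: norm_mult power_mult_distrib)
    then show ?thesis using f(3)[of w] v by (simp add: g_def comp_op_def w_def[symmetric] v_def[symmetric])
  qed
  ultimately have A: "1 / (4 * v^2) \<le> 4 * hardy_norm p g powr p / Im z" by simp
  have gn: "hardy_norm p g \<ge> 0" and fn: "hardy_norm p f \<ge> 0" using hardy_norm_nonneg g f by auto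
  have "hardy_norm p g \<noteq> 0"
  proof
    assume "hardy_norm p g = 0"
    then have "1 / (4 * v^2) \<le> 0" using A p by simp
    then show False using v by simp
  qed
  then have "C * hardy_norm p f > 0" using g gn by linarith
  then show Cp: "C > 0" using fn by (simp add: zero_less_mult_iff)
  have "hardy_norm p g powr p \<le> (C * hardy_norm p f) powr p" using g gn p by (intro powr_mono2) auto
  also have "\<dots> = C powr p * hardy_norm p f powr p" using Cp fn by (simp add: powr_mult)
  also have "\<dots> \<le> C powr p * (pi / v)" using f by (intro mult_left_mono) auto
  finally have "hardy_norm p g powr p \<le> C powr p * (pi / v)" .
  then have "4 * hardy_norm p g powr p / Im z \<le> 4 * (C powr p * (pi / v)) / Im z" using z by (intro divide_right_mono) auto
  with A have "1 / (4 * v^2) \<le> 4 * (C powr p * (pi / v)) / Im z" by linarith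
  then have "1 / (4 * v^2) * (4 * v^2 * Im z) \<le> 4 * (C powr p * (pi / v)) / Im z * (4 * v^2 * Im z)"
    using z by (intro mult_right_mono) auto
  moreover have "1 / (4 * v^2) * (4 * v^2 * Im z) = Im z" using v by simp
  moreover have "4 * (C powr p * (pi / v)) / Im z * (4 * v^2 * Im z) = 16 * pi * C powr p * v"
    using v z by (simp add: power2_eq_square)
  ultimately show "Im z \<le> 16 * pi * C powr p * Im (\<phi> z)" unfolding v_def w_def by linarith
qed

section \<open>The flow and its generator\<close>

lemma right_derivative_mono:
  fixes f g :: "real \<Rightarrow> real"
  assumes f: "(f has_real_derivative a) (at 0 within {0..})" and g: "(g has_real_derivative b) (at 0 within {0..})"
    and eq: "f 0 = g 0" and h: "h \<longlonglongrightarrow> 0" "\<And>n. h n > 0" and le: "\<And>n. f (h n) \<le> g (h n)"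
  shows "a \<le> b"
proof (rule LIMSEQ_le)
  have fl: "filterlim h (at 0 within {0..}) sequentially"
    unfolding filterlim_at using h by (auto intro!: always_eventually less_imp_le less_imp_neq[symmetric])
  show "(\<lambda>n. (f (h n) - f 0) / (h n - 0)) \<longlonglongrightarrow> a"
    using f unfolding has_field_derivative_iff by (rule filterlim_compose[OF _ fl])
  show "(\<lambda>n. (g (h n) - g 0) / (h n - 0)) \<longlonglongrightarrow> b"
    using g unfolding has_field_derivative_iff by (rule filterlim_compose[OF _ fl])
  have "(f (h n) - f 0) / (h n - 0) \<le> (g (h n) - g 0) / (h n - 0)" for n
    using le[of n] h(2)[of n] eq by (intro divide_right_mono) auto
  then show "\<exists>N. \<forall>n\<ge>N. (f (h n) - f 0) / (h n - 0) \<le> (g (h n) - g 0) / (h n - 0)" by blast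
qed

locale generated_semigroup =
  fixes \<phi> :: "real \<Rightarrow> complex \<Rightarrow> complex" and G :: "complex \<Rightarrow> complex"
  assumes semigroup: "analytic_semigroup \<phi>" and generator: "infinitesimal_generator \<phi> G"
begin

lemma hol: "t \<ge> 0 \<Longrightarrow> \<phi> t holomorphic_on upper_half_plane"
  using semigroup by (simp add: analytic_semigroup_def)

lemma Im_pos: "t \<ge> 0 \<Longrightarrow> Im z > 0 \<Longrightarrow> Im (\<phi> t z) > 0"
  using semigroup unfolding analytic_semigroup_def upper_half_plane_def by blast

lemma flow_0: "Im z > 0 \<Longrightarrow> \<phi> 0 z = z"
  using semigroup by (simp add: analytic_semigroup_def upper_half_plane_def)

lemma flow_add: "t \<ge> 0 \<Longrightarrow> s \<ge> 0 \<Longrightarrow> Im z > 0 \<Longrightarrow> \<phi> (t + s) z = \<phi> t (\<phi> s z)"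
  using semigroup by (simp add: analytic_semigroup_def upper_half_plane_def)

lemma generator_holomorphic: "G holomorphic_on upper_half_plane"
  using generator by (simp add: infinitesimal_generator_def)

lemma orbit_continuous: "Im z > 0 \<Longrightarrow> continuous_on {0..} (\<lambda>t. \<phi> t z)"
proof -
  assume z: "Im z > 0"
  have "continuous_on ({0..} \<times> upper_half_plane) (\<lambda>(t, z). \<phi> t z)"
    using semigroup by (simp add: analytic_semigroup_def)
  moreover have "continuous_on {0..} (\<lambda>t::real. (t, z))" by (intro continuous_intros)
  moreover have "(\<lambda>t::real. (t, z)) ` {0..} \<subseteq> {0..} \<times> upper_half_plane" using z by (auto simp: upper_half_plane_def)
  ultimately have "continuous_on {0..} (\<lambda>t. case (t, z) of (t, z) \<Rightarrow> \<phi> t z)" by (rule continuous_on_compose2)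
  then show ?thesis by simp
qed

text \<open>
  The generator is given as a limit of derivatives at positive times; continuity of the orbit at time 0
  and the mean value inequality turn it into a one-sided derivative.
\<close>
lemma right_derivative_0:
  assumes z: "Im z > 0"
  shows "((\<lambda>t. \<phi> t z) has_vector_derivative G z) (at 0 within {0..})"
proof -
  obtain D where D: "\<And>t. t > 0 \<Longrightarrow> ((\<lambda>s. \<phi> s z) has_vector_derivative D t) (at t)" "(D \<longlongrightarrow> G z) (at_right 0)"
    using generator z unfolding infinitesimal_generator_def upper_half_plane_def by blast
  have "\<exists>d>0. \<forall>y\<in>{0..}. norm (y - 0) < d \<longrightarrow> norm (\<phi> y z - \<phi> 0 z - (y - 0) *\<^sub>R G z) \<le> e * norm (y - 0)" if e: "e > 0" for e
  proof -
    have "\<forall>\<^sub>F s in at_right 0. dist (D s) (G z) < e" using tendstoD[OF D(2) e] .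
    then obtain d where d: "d > 0" "\<And>s. 0 < s \<Longrightarrow> s < d \<Longrightarrow> norm (D s - G z) < e"
      unfolding eventually_at_right_field dist_norm by blast
    show ?thesis
    proof (intro exI[of _ d] conjI ballI impI d(1))
      fix t :: real assume t: "t \<in> {0..}" "norm (t - 0) < d"
      show "norm (\<phi> t z - \<phi> 0 z - (t - 0) *\<^sub>R G z) \<le> e * norm (t - 0)"
      proof (cases "t = 0")
        case False
        then have t0: "0 < t" "t < d" using t by auto
        have "norm ((\<phi> t z - t *\<^sub>R G z) - (\<phi> 0 z - 0 *\<^sub>R G z)) \<le> e * t - e * 0"
        proof (rule differentiable_bound_general[OF t0(1)])
          show "continuous_on {0..t} (\<lambda>s. \<phi> s z - s *\<^sub>R G z)"
            by (intro continuous_intros continuous_on_subset[OF orbit_continuous[OF z]]) auto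
          show "continuous_on {0..t} ((*) e)" by (intro continuous_intros)
          fix s assume s: "0 < s" "s < t"
          show "((\<lambda>s. \<phi> s z - s *\<^sub>R G z) has_vector_derivative (D s - G z)) (at s)"
            using D(1)[OF s(1)] by (auto intro!: derivative_eq_intros)
          show "((*) e has_vector_derivative e) (at s)"
            by (auto intro!: derivative_eq_intros simp flip: has_real_derivative_iff_has_vector_derivative)
          show "norm (D s - G z) \<le> e" using d(2)[of s] s t0 by simp
        qed
        then show ?thesis using t0 by (simp add: algebra_simps)
      qed simp
    qed
  qed
  then show ?thesis
    unfolding has_vector_derivative_def has_derivative_within_alt by (auto intro!: bounded_linear_intros)
qed

text \<open>
  The semigroup law makes the right derivative at time \<open>t\<close> the right derivative at time 0 of the
  orbit of \<open>\<phi> t z\<close>.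
\<close>
lemma flow_derivative:
  assumes z: "Im z > 0" and t: "t > 0"
  shows "((\<lambda>s. \<phi> s z) has_vector_derivative G (\<phi> t z)) (at t)"
proof -
  obtain D where D: "((\<lambda>s. \<phi> s z) has_vector_derivative D) (at t)"
    using generator z t unfolding infinitesimal_generator_def upper_half_plane_def by blast
  have "((\<lambda>s. s - t) has_vector_derivative 1) (at t within {t..})"
    by (auto intro!: derivative_eq_intros)
  moreover have "(\<lambda>s. s - t) ` {t..} = {0..}"
  proof (intro equalityI subsetI)
    fix x :: real assume "x \<in> {0..}"
    then show "x \<in> (\<lambda>s. s - t) ` {t..}" by (intro image_eqI[of _ _ "x + t"]) auto
  qed auto
  ultimately have "((\<lambda>h. \<phi> h (\<phi> t z)) \<circ> (\<lambda>s. s - t) has_vector_derivative 1 *\<^sub>R G (\<phi> t z)) (at t within {t..})"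
    using right_derivative_0[of "\<phi> t z"] Im_pos[of t z] z t by (intro vector_diff_chain_within) auto
  then have shifted: "((\<lambda>h. \<phi> h (\<phi> t z)) \<circ> (\<lambda>s. s - t) has_vector_derivative G (\<phi> t z)) (at t within {t..})"
    by (simp only: scaleR_one)
  have "((\<lambda>s. \<phi> s z) has_vector_derivative G (\<phi> t z)) (at t within {t..})"
  proof (rule has_vector_derivative_transform[OF _ _ shifted])
    show "\<phi> s z = ((\<lambda>h. \<phi> h (\<phi> t z)) \<circ> (\<lambda>s. s - t)) s" if "s \<in> {t..}" for s
      using flow_add[of "s - t" t z] that t z by simp
  qed simp
  moreover have "((\<lambda>s. \<phi> s z) has_vector_derivative D) (at t within {t..})"
    using D by (rule has_vector_derivative_at_within)
  moreover have "at t within {t..} \<noteq> bot" by (simp add: at_within_Ici_at_right)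
  ultimately have "G (\<phi> t z) = D" by (rule vector_derivative_unique_within[rotated])
  then show ?thesis using D by simp
qed

lemma Re_Im_right_derivative:
  assumes z: "Im z > 0"
  shows "((\<lambda>t. Re (\<phi> t z)) has_real_derivative Re (G z)) (at 0 within {0..})"
    "((\<lambda>t. Im (\<phi> t z)) has_real_derivative Im (G z)) (at 0 within {0..})"
  using right_derivative_0[OF z] by (simp_all add: has_vector_derivative_complex_iff)

text \<open>
  Each \<open>\<phi> t\<close> contracts the hyperbolic distance, with equality at \<open>t = 0\<close>; differentiating the Schwarz--Pick inequality
  there gives an inequality for \<open>G\<close>. It takes the place of the Berkson--Porta representation.
\<close>
lemma generator_two_point:
  assumes z: "Im z > 0" and w: "Im w > 0"
  shows "2 * Re (cnj (z - w) * (G z - G w)) * (Im z * Im w) \<le> norm (z - w)^2 * (Im (G z) * Im w + Im z * Im (G w))"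
proof -
  define f where "f = (\<lambda>t. ((Re (\<phi> t z) - Re (\<phi> t w))^2 + (Im (\<phi> t z) - Im (\<phi> t w))^2) * (Im z * Im w))"
  define g where "g = (\<lambda>t. norm (z - w)^2 * (Im (\<phi> t z) * Im (\<phi> t w)))"
  have f: "(f has_real_derivative (2 * Re (cnj (z - w) * (G z - G w)) * (Im z * Im w))) (at 0 within {0..})"
    unfolding f_def
    by (rule derivative_eq_intros Re_Im_right_derivative z w refl)+ (simp add: flow_0 z w algebra_simps)
  have g: "(g has_real_derivative (norm (z - w)^2 * (Im (G z) * Im w + Im z * Im (G w)))) (at 0 within {0..})"
    unfolding g_def
    by (rule derivative_eq_intros Re_Im_right_derivative z w refl)+ (simp add: flow_0 z w algebra_simps)
  show ?thesis
  proof (rule right_derivative_mono[OF f g])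
    show "f 0 = g 0" by (simp add: f_def g_def flow_0 z w cmod_power2)
    show "(\<lambda>n. 1 / real (Suc n)) \<longlonglongrightarrow> 0" by real_asymp
    show "f (1 / real (Suc n)) \<le> g (1 / real (Suc n))" for n
      using Schwarz_Pick[OF hol less_imp_le[OF Im_pos] z w, of "1 / real (Suc n)"]
      by (simp add: f_def g_def cmod_power2 mult.assoc)
  qed simp
qed

text \<open>
  The bound on \<open>G\<close> makes \<open>Im (\<phi> t z) * exp (- d * t)\<close> nondecreasing in time.
\<close>
lemma flow_lower_bound:
  assumes G: "\<And>z. Im z > 0 \<Longrightarrow> Im (G z) \<ge> d * Im z" and t: "t \<ge> 0" and z: "Im z > 0"
  shows "Im (\<phi> t z) \<ge> exp (d * t) * Im z"
proof (cases "t = 0")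
  case True then show ?thesis by (simp add: flow_0 z)
next
  case False
  then have t: "t > 0" using t by simp
  define F where "F = (\<lambda>s. Im (\<phi> s z) * exp (- (d * s)))"
  have "F 0 \<le> F t"
  proof (rule DERIV_nonneg_imp_increasing_open[of 0 t F])
    fix s assume s: "0 < s" "s < t"
    have "((\<lambda>s. Im (\<phi> s z)) has_real_derivative Im (G (\<phi> s z))) (at s)"
      using flow_derivative[OF z s(1)] by (simp add: has_vector_derivative_complex_iff)
    moreover have "((\<lambda>s. exp (- (d * s))) has_real_derivative - d * exp (- (d * s))) (at s)"
      by (auto intro!: derivative_eq_intros)
    ultimately have "((\<lambda>s. Im (\<phi> s z) * exp (- (d * s))) has_real_derivative
        Im (G (\<phi> s z)) * exp (- (d * s)) + - d * exp (- (d * s)) * Im (\<phi> s z)) (at s)"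
      by (rule DERIV_mult)
    then have "(F has_real_derivative (Im (G (\<phi> s z)) - d * Im (\<phi> s z)) * exp (- (d * s))) (at s)"
      unfolding F_def by (simp add: algebra_simps)
    moreover have "(Im (G (\<phi> s z)) - d * Im (\<phi> s z)) * exp (- (d * s)) \<ge> 0"
      using G[OF Im_pos[of s z]] s z by simp
    ultimately show "\<exists>y. (F has_real_derivative y) (at s) \<and> 0 \<le> y" by blast
  next
    show "continuous_on {0..t} F" unfolding F_def
      by (intro continuous_intros continuous_on_subset[OF orbit_continuous[OF z]]) auto
  qed (use t in simp)
  then have "Im z \<le> Im (\<phi> t z) * exp (- (d * t))" by (simp add: F_def flow_0 z)
  then have "exp (d * t) * Im z \<le> exp (d * t) * (Im (\<phi> t z) * exp (- (d * t)))" by (intro mult_left_mono) auto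
  also have "\<dots> = Im (\<phi> t z)" by (simp add: exp_minus)
  finally show ?thesis .
qed

text \<open>
  In the two-point inequality let \<open>w\<close> go to infinity along the imaginary axis, after division by \<open>(Im w)^3\<close>.
  The left side contributes \<open>2 * Re \<delta>\<close> and the right side \<open>Re \<delta>\<close>, which leaves the bound with constant \<open>Re \<delta>\<close>.
\<close>
lemma generator_lower_bound_of_limit:
  assumes lim: "nontangential_limit (\<lambda>z. G z / z) \<delta>" and z: "Im z > 0"
  shows "Im (G z) \<ge> Re \<delta> * Im z"
proof -
  define A where "A = (\<lambda>y::real. z / of_real y - \<i>)"
  define B where "B = (\<lambda>y::real. G z / of_real y - \<i> * (G (\<i> * of_real y) / (\<i> * of_real y)))"
  define C where "C = (\<lambda>y::real. Im (G (\<i> * of_real y)) / y)"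
  have van: "((\<lambda>y::real. c / of_real y) \<longlongrightarrow> (0::complex)) at_top" for c
    by (rule tendsto_divide_0[OF tendsto_const filterlim_of_real_at_infinity])
  have A: "(A \<longlongrightarrow> - \<i>) at_top" unfolding A_def using tendsto_diff[OF van[of z] tendsto_const[of \<i>]] by simp
  have B: "(B \<longlongrightarrow> - (\<i> * \<delta>)) at_top" unfolding B_def
    using tendsto_diff[OF van[of "G z"] tendsto_mult[OF tendsto_const[of \<i>] nontangential_limit_imaginary_axis[OF lim]]] by simp
  have C: "(C \<longlongrightarrow> Re \<delta>) at_top" unfolding C_def by (rule nontangential_limit_real_part[OF lim])
  have l: "((\<lambda>y. 2 * Re (cnj (A y) * B y) * Im z) \<longlongrightarrow> 2 * Re (cnj (- \<i>) * - (\<i> * \<delta>)) * Im z) at_top"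
    by (intro tendsto_intros A B)
  have r: "((\<lambda>y. norm (A y)^2 * (Im (G z) + Im z * C y)) \<longlongrightarrow> norm (- \<i>)^2 * (Im (G z) + Im z * Re \<delta>)) at_top"
    by (intro tendsto_intros A C)
  have "\<forall>\<^sub>F y in at_top. 2 * Re (cnj (A y) * B y) * Im z \<le> norm (A y)^2 * (Im (G z) + Im z * C y)"
    using eventually_gt_at_top[of 0]
  proof eventually_elim
    case (elim y)
    define w where "w = \<i> * complex_of_real y"
    have zA: "z - w = of_real y * A y" using elim by (simp add: A_def w_def field_simps)
    have GB: "G z - G w = of_real y * B y" using elim by (simp add: B_def w_def field_simps)
    have Cy: "Im (G w) = y * C y" using elim by (simp add: C_def w_def)
    have "2 * Re (cnj (z - w) * (G z - G w)) * (Im z * Im w) \<le> norm (z - w)^2 * (Im (G z) * Im w + Im z * Im (G w))"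
      by (rule generator_two_point[OF z]) (use elim in \<open>simp add: w_def\<close>)
    moreover have "cnj (z - w) * (G z - G w) = of_real (y^2) * (cnj (A y) * B y)"
      unfolding zA GB by (simp add: power2_eq_square)
    moreover have "norm (z - w)^2 = y^2 * norm (A y)^2" unfolding zA by (simp add: norm_mult power_mult_distrib)
    moreover have "Im w = y" by (simp add: w_def)
    ultimately have le: "2 * Re (of_real (y^2) * (cnj (A y) * B y)) * (Im z * y) \<le> y^2 * norm (A y)^2 * (Im (G z) * y + Im z * (y * C y))"
      by (simp only: Cy)
    have "y^3 * (2 * Re (cnj (A y) * B y) * Im z) \<le> y^3 * (norm (A y)^2 * (Im (G z) + Im z * C y))"
    proof -
      have "Re (of_real (y^2) * (cnj (A y) * B y)) = y^2 * Re (cnj (A y) * B y)"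
        by (simp only: times_complex.sel(1)[of "of_real (y^2)"] Re_complex_of_real Im_complex_of_real)
      with le show ?thesis by (simp only:) (simp add: power3_eq_cube power2_eq_square mult_ac distrib_left)
    qed
    then show ?case using elim by simp
  qed
  then have "2 * Re (cnj (- \<i>) * - (\<i> * \<delta>)) * Im z \<le> norm (- \<i>)^2 * (Im (G z) + Im z * Re \<delta>)"
    by (intro tendsto_le[OF _ r l]) auto
  then show ?thesis by (simp add: algebra_simps)
qed

text \<open>
  Angular derivatives at infinity multiply under composition, so those of \<open>\<phi> (t / n)\<close> are \<open>n\<close>-th roots of the one of \<open>\<phi> t\<close>.
  Hence the given bound at time \<open>t\<close> yields bounds \<open>b powr (1 / n)\<close> at time \<open>t / n\<close>, whose derivative at time 0 is \<open>ln b / t\<close>. The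
  trivial inequality between infima goes in the wrong direction here, so multiplicativity of the limits is essential.
\<close>
lemma generator_lower_bound_of_flow:
  assumes pos: "\<And>t. t \<ge> 0 \<Longrightarrow> \<exists>b>0. \<forall>z. Im z > 0 \<longrightarrow> Im (\<phi> t z) \<ge> b * Im z"
    and t: "t > 0" and b: "b > 0" "\<And>z. Im z > 0 \<Longrightarrow> Im (\<phi> t z) \<ge> b * Im z" and z: "Im z > 0"
  shows "Im (G z) \<ge> ln b / t * Im z"
proof -
  have "\<exists>\<kappa>. \<forall>s\<ge>0. \<kappa> s > 0 \<and> (\<forall>z. Im z > 0 \<longrightarrow> Im (\<phi> s z) \<ge> \<kappa> s * Im z) \<and> nontangential_limit (\<lambda>z. \<phi> s z / z) (of_real (\<kappa> s))"
  proof (intro choice allI)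
    fix s
    show "\<exists>\<kappa>. s \<ge> 0 \<longrightarrow> \<kappa> > 0 \<and> (\<forall>z. Im z > 0 \<longrightarrow> Im (\<phi> s z) \<ge> \<kappa> * Im z) \<and> nontangential_limit (\<lambda>z. \<phi> s z / z) (of_real \<kappa>)"
    proof (cases "s \<ge> 0")
      case True
      then obtain c where c: "c > 0" "\<And>z. Im z > 0 \<Longrightarrow> Im (\<phi> s z) \<ge> c * Im z" using pos by blast
      obtain \<kappa> where "\<kappa> \<ge> c" "\<And>z. Im z > 0 \<Longrightarrow> Im (\<phi> s z) \<ge> \<kappa> * Im z" "nontangential_limit (\<lambda>z. \<phi> s z / z) (of_real \<kappa>)"
        using angular_derivative_exists[OF hol[OF True] c(2)] by blast
      then show ?thesis using c by (intro exI[of _ \<kappa>]) auto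
    qed simp
  qed
  then obtain \<kappa> where \<kappa>: "\<And>s. s \<ge> 0 \<Longrightarrow> \<kappa> s > 0" "\<And>s z. s \<ge> 0 \<Longrightarrow> Im z > 0 \<Longrightarrow> Im (\<phi> s z) \<ge> \<kappa> s * Im z"
    "\<And>s. s \<ge> 0 \<Longrightarrow> nontangential_limit (\<lambda>z. \<phi> s z / z) (of_real (\<kappa> s))" by blast
  have mult: "\<kappa> (r + s) = \<kappa> r * \<kappa> s" if "r \<ge> 0" "s \<ge> 0" for r s
    using that by (intro angular_derivative_compose[OF \<kappa>(3) \<kappa>(3) \<kappa>(1) \<kappa>(3)]) (auto simp: flow_add)
  have power: "\<kappa> (real (Suc n) * s) = \<kappa> s ^ Suc n" if "s \<ge> 0" for n s
  proof (induction n)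
    case (Suc n)
    have "\<kappa> (real (Suc (Suc n)) * s) = \<kappa> (s + real (Suc n) * s)" by (simp add: algebra_simps)
    also have "\<dots> = \<kappa> s * \<kappa> (real (Suc n) * s)" using that by (intro mult) auto
    finally show ?case by (simp only: Suc.IH power_Suc)
  qed simp
  have t0: "t \<ge> 0" using t by simp
  have "b \<le> \<kappa> t" using angular_derivative_lower_bound[OF \<kappa>(3)[OF t0] b(2)] by simp
  define h where "h = (\<lambda>n. t / real (Suc n))"
  have h: "h n > 0" for n using t by (simp add: h_def)
  have root: "exp (ln b / t * h n) \<le> \<kappa> (h n)" for n
  proof -
    have "real (Suc n) * h n = t" by (simp add: h_def del: of_nat_Suc)
    then have "\<kappa> t = \<kappa> (h n) ^ Suc n" using power[OF less_imp_le[OF h], of n n] by (simp only:)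
    then have "ln b \<le> ln (\<kappa> (h n) ^ Suc n)" using \<open>b \<le> \<kappa> t\<close> b(1) by simp
    also have "\<dots> = real (Suc n) * ln (\<kappa> (h n))" using \<kappa>(1)[of "h n"] h[of n] by (subst ln_realpow) auto
    finally have "ln b / real (Suc n) \<le> ln (\<kappa> (h n))" by (simp add: pos_divide_le_eq mult.commute del: of_nat_Suc)
    moreover have "ln b / t * h n = ln b / real (Suc n)" using t by (simp add: h_def)
    ultimately have "exp (ln b / t * h n) \<le> exp (ln (\<kappa> (h n)))" by simp
    then show ?thesis using \<kappa>(1)[of "h n"] h[of n] by simp
  qed
  have f: "((\<lambda>s. exp (ln b / t * s) * Im z) has_real_derivative ln b / t * Im z) (at 0 within {0..})"
    using t by (auto intro!: derivative_eq_intros)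
  show ?thesis
  proof (rule right_derivative_mono[OF f Re_Im_right_derivative(2)[OF z]])
    show "h \<longlonglongrightarrow> 0" unfolding h_def by real_asymp
    show "exp (ln b / t * h n) * Im z \<le> Im (\<phi> (h n) z)" for n
    proof -
      have "exp (ln b / t * h n) * Im z \<le> \<kappa> (h n) * Im z" using root z by (intro mult_right_mono) auto
      also have "\<dots> \<le> Im (\<phi> (h n) z)" using \<kappa>(2)[of "h n" z] h[of n] z by simp
      finally show ?thesis .
    qed
  qed (use h z in \<open>auto simp: flow_0\<close>)
qed

text \<open>
  The constant is \<open>\<delta> = Inf (Im (G z) / Im z)\<close>, finite by the previous lemma and equal to the angular limit of \<open>G z / z\<close> by the
  Julia--Wolff--Caratheodory theorem.
\<close>
lemma sharp_flow_bound:
  assumes pos: "\<And>t. t \<ge> 0 \<Longrightarrow> \<exists>b>0. \<forall>z. Im z > 0 \<longrightarrow> Im (\<phi> t z) \<ge> b * Im z"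
  obtains \<delta> :: real where "nontangential_limit (\<lambda>z. G z / z) (of_real \<delta>)"
    "\<And>t z. t \<ge> 0 \<Longrightarrow> Im z > 0 \<Longrightarrow> Im (\<phi> t z) \<ge> exp (\<delta> * t) * Im z"
    "\<And>t b. t \<ge> 0 \<Longrightarrow> (\<And>z. Im z > 0 \<Longrightarrow> Im (\<phi> t z) \<ge> b * Im z) \<Longrightarrow> b \<le> exp (\<delta> * t)"
proof -
  obtain b1 where b1: "b1 > 0" "\<And>z. Im z > 0 \<Longrightarrow> Im (\<phi> 1 z) \<ge> b1 * Im z" using pos[of 1] by auto
  have "Im (G z) \<ge> ln b1 / 1 * Im z" if "Im z > 0" for z
    by (rule generator_lower_bound_of_flow[OF pos _ b1]) (use that in auto)
  then obtain \<delta> where \<delta>: "\<And>z. Im z > 0 \<Longrightarrow> Im (G z) \<ge> \<delta> * Im z" "nontangential_limit (\<lambda>z. G z / z) (of_real \<delta>)"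
    using angular_derivative_exists[OF generator_holomorphic] by blast
  show ?thesis
  proof (rule that[OF \<delta>(2)])
    show "Im (\<phi> t z) \<ge> exp (\<delta> * t) * Im z" if "t \<ge> 0" "Im z > 0" for t z
      by (rule flow_lower_bound[OF \<delta>(1) that])
    fix t b :: real assume t: "t \<ge> 0" and b: "\<And>z. Im z > 0 \<Longrightarrow> Im (\<phi> t z) \<ge> b * Im z"
    show "b \<le> exp (\<delta> * t)"
    proof (cases "b \<le> 0")
      case True
      then show ?thesis by (rule order_trans) simp
    next
      case False
      show ?thesis
      proof (cases "t = 0")
        case True
        then show ?thesis using b[of \<i>] by (simp add: flow_0)
      next
        case tn: False
        have "Im (G z) \<ge> ln b / t * Im z" if "Im z > 0" for z
          by (rule generator_lower_bound_of_flow[OF pos _ _ b]) (use that tn t False in auto)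
        from angular_derivative_lower_bound[OF \<delta>(2) this]
        have "ln b \<le> \<delta> * t" using tn t by (simp add: pos_divide_le_eq)
        then have "exp (ln b) \<le> exp (\<delta> * t)" by simp
        then show ?thesis using False by simp
      qed
    qed
  qed
qed

end

section \<open>Boundedness and norm of the operators of a semigroup\<close>

context generated_semigroup
begin

lemma hardy_bound_iterate:
  assumes C: "hardy_bound p (comp_op (\<phi> t)) C" "C \<ge> 0" and t: "t \<ge> 0"
  shows "hardy_bound p (comp_op (\<phi> (real n * t))) (C ^ n)"
proof (induction n)
  case 0
  have "comp_op (\<phi> 0) f \<in> hardy_space p \<and> hardy_norm p (comp_op (\<phi> 0) f) \<le> hardy_norm p f" if "f \<in> hardy_space p" for f
    using hardy_cong[of "comp_op (\<phi> 0) f" f p] that by (simp add: comp_op_def flow_0)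
  then show ?case by (simp add: hardy_bound_def)
next
  case (Suc n)
  show ?case unfolding hardy_bound_def
  proof (intro ballI)
    fix f assume f: "f \<in> hardy_space p"
    define g where "g = comp_op (\<phi> t) f"
    define k where "k = comp_op (\<phi> (real n * t)) g"
    have g: "g \<in> hardy_space p" "hardy_norm p g \<le> C * hardy_norm p f"
      using C f by (auto simp: hardy_bound_def g_def)
    have k: "k \<in> hardy_space p" "hardy_norm p k \<le> C ^ n * hardy_norm p g"
      using Suc.IH g by (auto simp: hardy_bound_def k_def)
    have eq: "comp_op (\<phi> (real (Suc n) * t)) f z = k z" if "Im z > 0" for z
    proof -
      have "real (Suc n) * t = t + real n * t" by (simp add: algebra_simps)
      then show ?thesis using flow_add[of t "real n * t" z] t that by (simp add: k_def g_def comp_op_def)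
    qed
    have "hardy_norm p k \<le> C ^ n * (C * hardy_norm p f)"
      using k(2) g(2) C(2) by (meson mult_left_mono order_trans zero_le_power)
    then show "comp_op (\<phi> (real (Suc n) * t)) f \<in> hardy_space p \<and>
        hardy_norm p (comp_op (\<phi> (real (Suc n) * t)) f) \<le> C ^ Suc n * hardy_norm p f"
      using hardy_cong[where p = p, OF eq] k(1) by (simp add: mult_ac)
  qed
qed

lemma flow_bound_of_hardy_bounded:
  assumes p: "0 < p" and t: "t \<ge> 0" and bd: "hardy_bounded p (comp_op (\<phi> t))"
  shows "\<exists>b>0. \<forall>z. Im z > 0 \<longrightarrow> Im (\<phi> t z) \<ge> b * Im z"
proof -
  obtain C where C: "hardy_bound p (comp_op (\<phi> t)) C" using bd by (auto simp: hardy_bounded_def)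
  have B: "C > 0" "Im z \<le> 16 * pi * C powr p * Im (\<phi> t z)" if "Im z > 0" for z
    using composition_bound_imp[OF _ p C that] Im_pos[OF t] by blast+
  have Cp: "C > 0" using B(1)[of \<i>] by simp
  define K where "K = 16 * pi * C powr p"
  have K: "K > 0" using Cp by (simp add: K_def)
  have "1 / K * Im z \<le> Im (\<phi> t z)" if "Im z > 0" for z
  proof -
    have "Im z \<le> K * Im (\<phi> t z)" unfolding K_def by (rule B(2)[OF that])
    then show ?thesis using K by (simp add: pos_divide_le_eq mult.commute)
  qed
  then show ?thesis using K by (intro exI[of _ "1 / K"]) simp
qed

text \<open>
  A bound \<open>C\<close> at time \<open>t\<close> gives the bound \<open>C ^ n\<close> at time \<open>n * t\<close>. The test functions then show that \<open>(C powr p * exp (\<delta> * t)) ^ n\<close>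
  stays above \<open>1 / (16 * pi)\<close> for all \<open>n\<close>, so the base is at least 1.
\<close>
lemma hardy_opnorm_flow:
  assumes p: "0 < p" and t: "t \<ge> 0"
    and lower: "\<And>t z. t \<ge> 0 \<Longrightarrow> Im z > 0 \<Longrightarrow> Im (\<phi> t z) \<ge> exp (\<delta> * t) * Im z"
    and sharp: "\<And>t b. t \<ge> 0 \<Longrightarrow> (\<And>z. Im z > 0 \<Longrightarrow> Im (\<phi> t z) \<ge> b * Im z) \<Longrightarrow> b \<le> exp (\<delta> * t)"
  shows "hardy_opnorm p (comp_op (\<phi> t)) = exp (- \<delta> * t / p)"
  unfolding hardy_opnorm_def
proof (rule Least_equality)
  have "hardy_bound p (comp_op (\<phi> t)) ((1 / exp (\<delta> * t)) powr (1 / p))"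
    by (rule composition_bounded[OF hol[OF t] _ lower[OF t] p]) auto
  moreover have "(1 / exp (\<delta> * t)) powr (1 / p) = exp (- \<delta> * t / p)"
    by (simp add: powr_def ln_div)
  ultimately show "hardy_bound p (comp_op (\<phi> t)) (exp (- \<delta> * t / p))" by simp
next
  fix C assume C: "hardy_bound p (comp_op (\<phi> t)) C"
  have Cp: "C > 0" using composition_bound_imp(1)[OF _ p C, of \<i>] Im_pos[OF t] by auto
  define x where "x = C powr p * exp (\<delta> * t)"
  have x: "x > 0" using Cp by (simp add: x_def)
  have bound: "1 / (16 * pi) \<le> x ^ n" for n
  proof -
    define K where "K = 16 * pi * (C ^ n) powr p"
    have K: "K > 0" using Cp by (simp add: K_def)
    have nt: "real n * t \<ge> 0" using t by simp
    have B: "Im z \<le> K * Im (\<phi> (real n * t) z)" if "Im z > 0" for z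
      unfolding K_def
      using composition_bound_imp(2)[OF _ p hardy_bound_iterate[OF C less_imp_le[OF Cp] t] that] Im_pos[OF nt] by blast
    have "1 / K \<le> exp (\<delta> * (real n * t))"
    proof (rule sharp[OF nt])
      fix z :: complex assume "Im z > 0"
      from B[OF this] show "1 / K * Im z \<le> Im (\<phi> (real n * t) z)"
        using K by (simp add: pos_divide_le_eq K_def[symmetric] mult.commute)
    qed
    then have "1 \<le> K * exp (\<delta> * (real n * t))" using K by (simp add: pos_divide_le_eq mult.commute)
    moreover have "(C ^ n) powr p = (C powr p) ^ n" using Cp by (simp add: powr_power powr_powr powr_realpow[symmetric] mult.commute)
    moreover have "exp (\<delta> * (real n * t)) = exp (\<delta> * t) ^ n" by (simp add: exp_of_nat_mult[symmetric] mult_ac)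
    ultimately have "1 \<le> 16 * pi * x ^ n" by (simp add: K_def x_def power_mult_distrib)
    then show ?thesis by (simp add: pos_divide_le_eq mult.commute)
  qed
  have "x \<ge> 1"
  proof (rule ccontr)
    assume "\<not> x \<ge> 1"
    then obtain n where "x ^ n < 1 / (16 * pi)" using real_arch_pow_inv[of "1 / (16 * pi)" x] by auto
    then show False using bound[of n] by simp
  qed
  then have "exp (- (\<delta> * t)) \<le> C powr p" by (simp add: x_def exp_minus divide_simps)
  then have "exp (- (\<delta> * t)) powr (1 / p) \<le> (C powr p) powr (1 / p)" using p by (intro powr_mono2) auto
  moreover have "(C powr p) powr (1 / p) = C" using Cp p by (simp add: powr_powr)
  moreover have "exp (- (\<delta> * t)) powr (1 / p) = exp (- \<delta> * t / p)" by (simp add: powr_def)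
  ultimately show "exp (- \<delta> * t / p) \<le> C" by simp
qed

end

theorem theorem2p8:
  fixes \<phi> :: "real \<Rightarrow> complex \<Rightarrow> complex" and G :: "complex \<Rightarrow> complex" and p :: real
  assumes "analytic_semigroup \<phi>"
    and "infinitesimal_generator \<phi> G"
    and "0 < p"
  shows "((\<forall>t\<ge>0. hardy_bounded p (comp_op (\<phi> t))) \<longleftrightarrow>
            (\<exists>\<delta>. nontangential_limit (\<lambda>z. G z / z) \<delta>)) \<and>
         ((\<exists>\<delta>. nontangential_limit (\<lambda>z. G z / z) \<delta>) \<longleftrightarrow>
            (\<exists>c. nontangential_limit (deriv G) c)) \<and>
         ((\<forall>t\<ge>0. hardy_bounded p (comp_op (\<phi> t))) \<or>
          (\<exists>\<delta>. nontangential_limit (\<lambda>z. G z / z) \<delta>) \<or>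
          (\<exists>c. nontangential_limit (deriv G) c)
          \<longrightarrow> (\<exists>\<delta>::real.
                 nontangential_limit (\<lambda>z. G z / z) (complex_of_real \<delta>) \<and>
                 nontangential_limit (deriv G) (complex_of_real \<delta>) \<and>
                 (\<forall>t\<ge>0. hardy_opnorm p (comp_op (\<phi> t)) = exp (- \<delta> * t / p))))"
proof -
  interpret generated_semigroup \<phi> G using assms(1,2) by unfold_locales
  note p = \<open>0 < p\<close>
  have lim_iff: "nontangential_limit (\<lambda>z. G z / z) c \<longleftrightarrow> nontangential_limit (deriv G) c" for c
    using nontangential_limit_deriv[OF generator_holomorphic] nontangential_limit_quotient[OF generator_holomorphic] by blast
  have bounded: "hardy_bounded p (comp_op (\<phi> t))" if lim: "nontangential_limit (\<lambda>z. G z / z) \<delta>" and t: "t \<ge> 0" for \<delta> t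
  proof -
    have "Im (\<phi> t z) \<ge> exp (Re \<delta> * t) * Im z" if "Im z > 0" for z
      by (rule flow_lower_bound[OF generator_lower_bound_of_limit[OF lim] t that])
    from composition_bounded[OF hol[OF t] _ this p] show ?thesis unfolding hardy_bounded_def by auto
  qed
  have real: "\<exists>\<delta>::real. nontangential_limit (\<lambda>z. G z / z) (complex_of_real \<delta>) \<and>
      nontangential_limit (deriv G) (complex_of_real \<delta>) \<and>
      (\<forall>t\<ge>0. hardy_opnorm p (comp_op (\<phi> t)) = exp (- \<delta> * t / p))"
    if bd: "\<forall>t\<ge>0. hardy_bounded p (comp_op (\<phi> t))"
  proof -
    have flow: "\<exists>b>0. \<forall>z. Im z > 0 \<longrightarrow> Im (\<phi> t z) \<ge> b * Im z" if "t \<ge> 0" for t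
      using bd that by (intro flow_bound_of_hardy_bounded[OF p that]) blast
    show ?thesis
    proof (rule sharp_flow_bound[OF flow])
      fix \<delta> :: real
      assume lim: "nontangential_limit (\<lambda>z. G z / z) (of_real \<delta>)"
        and lower: "\<And>t z. t \<ge> 0 \<Longrightarrow> Im z > 0 \<Longrightarrow> Im (\<phi> t z) \<ge> exp (\<delta> * t) * Im z"
        and sharp: "\<And>t b. t \<ge> 0 \<Longrightarrow> (\<And>z. Im z > 0 \<Longrightarrow> Im (\<phi> t z) \<ge> b * Im z) \<Longrightarrow> b \<le> exp (\<delta> * t)"
      have "hardy_opnorm p (comp_op (\<phi> t)) = exp (- \<delta> * t / p)" if "t \<ge> 0" for t
        by (rule hardy_opnorm_flow[OF p that lower sharp])
      then show ?thesis using lim lim_iff by blast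
    qed
  qed
  have "(\<forall>t\<ge>0. hardy_bounded p (comp_op (\<phi> t))) \<longleftrightarrow> (\<exists>\<delta>. nontangential_limit (\<lambda>z. G z / z) \<delta>)"
    using real bounded by blast
  then show ?thesis using real lim_iff by blast
qed

end
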